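(* Let $X\subset\mathbb P^n_{\mathbf w}$ be a weighted hypersurface over $\mathbb F_q$ of dimension $\delta$, with $p\nmid w_i$ for all $i$, and suppose every nonempty sector $X^{(e)}\otimes\mathbb F_{q^{o_e}}$, $e\in E_{\mathbf w}$, is self-dual. If every nonempty sector has dimension $\delta$, then for each $s\in\{1,0,-1,-2,\ldots\}$ one has $$Z_H^{\mathrm{can}}\!\left(\mathfrak X,s;\frac{1}{q^{\delta}t}\right)=\pm q^{\delta N_s/2}t^{N_s}Z_H^{\mathrm{can}}(\mathfrak X,s;t),\qquad N_s:=\sum_{e\in E_{\mathbf w}}J_{1-s}(e)\,\chi\!\left(X^{(e)}\right).$$ In particular, at $s=0$, $$Z^{\mathrm{tw}}\!\left(\mathfrak X,\frac{1}{q^{\delta}t}\right)=\pm q^{\delta N_0/2}t^{N_0}Z^{\mathrm{tw}}(\mathfrak X,t),\qquad N_0=\sum_{e\in E_{\mathbf w}}\phi(e)\,\chi\!\left(X^{(e)}\right).$$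
   Context: $q$ is a power of a prime $p$; $\mathbf w=(w_0,\dots,w_n)$ is a vector of positive integers; $\mathbb G_m$ acts on $\mathbb A^{n+1}\setminus\{0\}$ by $\lambda\cdot(x_i)=(\lambda^{w_i}x_i)$; $\mathbb P^n_{\mathbf w}$ is the weighted projective space (coarse space of $[(\mathbb A^{n+1}\setminus\{0\})/\mathbb G_m]$). A weighted hypersurface is $X=V(f)\subset\mathbb P^n_{\mathbf w}$, $f$ weighted homogeneous over $\mathbb F_q$, with affine cone $\hat X=\{f=0\}\subset\mathbb A^{n+1}$ and stack $\mathfrak X=[(\hat X\setminus\{0\})/\mathbb G_m]$. For $\mathbf x\in X(\mathbb F_{q^r})$ (points of the coarse variety), $g_{\mathbf x}(r)=\gcd(k_{S(\mathbf x)},q^r-1)$ with $S(\mathbf x)=\{i:x_i\neq0\}$, $k_S=\gcd(w_i:i\in S)$. Put $$\Theta_r(s)=\sum_{\mathbf x\in X(\mathbb F_{q^r})}g_{\mathbf x}(r)^{1-s},\qquad Z_H^{\mathrm{can}}(\mathfrak X,s;t)=\exp\Bigl(\sum_{r\ge1}\Theta_r(s)\frac{t^r}{r}\Bigr),$$ which for $s\in\{1,0,-1,\dots\}$ is a rational function of $t$. $Z^{\mathrm{tw}}(\mathfrak X,t)=\exp(\sum_r\#\pi_0(\mathfrak X(\mathbb F_{q^r}))t^r/r)=Z_H^{\mathrm{can}}(\mathfrak X,0;t)$, where $\pi_0(\mathfrak X(\mathbb F_{q^r}))$ is the set of isomorphism classes of the groupoid $\mathfrak X(\mathbb F_{q^r})$.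 Sectors: $E_{\mathbf w}$ is the set of integers $e\ge1$, prime to $p$, dividing at least one $w_i$; $X^{(e)}=X\cap\{x_i=0\text{ for all }i\text{ with }e\nmid w_i\}$; $o_e$ is the multiplicative order of $q$ mod $e$ ($o_1=1$); $J_{1-s}(e)=\sum_{e'\mid e}\mu(e/e')(e')^{1-s}$ with $\mu$ the Möbius function; $\phi$ is Euler's function; $\chi$ is the $\ell$-adic Euler characteristic ($\chi(\varnothing)=0$). A projective variety $Y$ of dimension $\delta_Y$ over a finite field $\mathbb F_Q$ is self-dual if $Z(Y,1/(Q^{\delta_Y}T))=\pm Q^{\delta_Y\chi/2}T^{\chi}Z(Y,T)$ with $\chi=\chi(Y)$ the $\ell$-adic Euler characteristic, $Z(Y,T)$ being the Hasse–Weil zeta function. *)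

theory Defs
  imports
    "HOL-Analysis.Abstract_Topology"
    "HOL-Library.Cardinality"
    "HOL-Library.Extended_Real"
    "HOL-Library.Poly_Mapping"
    "HOL-Computational_Algebra.Computational_Algebra"
    "HOL-Number_Theory.Number_Theory"
    "HOL-Algebra.Algebraic_Closure_Type"
begin

section \<open>Weighted homogeneous polynomials and weighted projective space\<close>

text \<open>
  The finite index type \<open>'i\<close> stands for \<open>{0, \<dots>, n}\<close>. A monomial is a finitely supported
  exponent function. In the geometric part \<open>'k\<close> is always used for an algebraically closed
  field, and a variety is given by its \<open>'k\<close>-points with the Zariski topology. Dimension, point counts
  and \<open>\<ell>\<close>-adic cohomology only depend on the underlying reduced variety.
\<close>

type_synonym ('v, 'k) mpoly = "('v \<Rightarrow>\<^sub>0 nat) \<Rightarrow>\<^sub>0 'k"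

definition mp_eval :: "('v, 'k::comm_ring_1) mpoly \<Rightarrow> ('v \<Rightarrow> 'k) \<Rightarrow> 'k" where
  "mp_eval h x = (\<Sum>m\<in>Poly_Mapping.keys h.
     Poly_Mapping.lookup h m * (\<Prod>v\<in>Poly_Mapping.keys m. x v ^ Poly_Mapping.lookup m v))"

definition whomog :: "('v \<Rightarrow> nat) \<Rightarrow> nat \<Rightarrow> ('v, 'k::zero) mpoly \<Rightarrow> bool" where
  "whomog w d h \<longleftrightarrow> (\<forall>m\<in>Poly_Mapping.keys h.
     (\<Sum>v\<in>Poly_Mapping.keys m. w v * Poly_Mapping.lookup m v) = d)"

definition wscale :: "('i \<Rightarrow> nat) \<Rightarrow> 'k::field \<Rightarrow> ('i \<Rightarrow> 'k) \<Rightarrow> ('i \<Rightarrow> 'k)" where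
  "wscale w c x = (\<lambda>i. c ^ w i * x i)"

text \<open>
  The \<open>'k\<close>-points of the coarse space \<open>\<P>\<^sub>w\<close> are the \<open>\<G>\<^sub>m('k)\<close>-orbits of nonzero vectors. A
  subvariety of \<open>\<P>\<^sub>w\<close> is represented by its punctured affine cone \<open>C\<close>, a \<open>\<G>\<^sub>m\<close>-stable set of
  nonzero vectors.
\<close>

definition worbit :: "('i \<Rightarrow> nat) \<Rightarrow> ('i \<Rightarrow> 'k::field) \<Rightarrow> ('i \<Rightarrow> 'k) set" where
  "worbit w x = {wscale w c x |c. c \<noteq> 0}"

definition coarse_points :: "('i \<Rightarrow> nat) \<Rightarrow> ('i \<Rightarrow> 'k::field) set \<Rightarrow> ('i \<Rightarrow> 'k) set set" where
  "coarse_points w C = worbit w ` C"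

definition wproj_zariski :: "('i \<Rightarrow> nat) \<Rightarrow> ('i \<Rightarrow> 'k::field) set topology" where
  "wproj_zariski w = topology_generated_by
     {coarse_points w {x. x \<noteq> (\<lambda>_. 0) \<and> mp_eval h x \<noteq> 0} |h d. whomog w d h}"

definition irreducible_closed :: "'a topology \<Rightarrow> 'a set \<Rightarrow> bool" where
  "irreducible_closed T Z \<longleftrightarrow> closedin T Z \<and> Z \<noteq> {} \<and>
     (\<forall>A B. closedin T A \<and> closedin T B \<and> Z = A \<union> B \<longrightarrow> Z = A \<or> Z = B)"

text \<open>Krull dimension; the empty space has dimension \<open>-\<infinity>\<close>.\<close>

definition krull_dim :: "'a topology \<Rightarrow> ereal" where
  "krull_dim T = Sup {ereal (real m) |m. \<exists>Z :: nat \<Rightarrow> 'a set.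
     (\<forall>j\<le>m. irreducible_closed T (Z j)) \<and> (\<forall>j<m. Z j \<subset> Z (Suc j))}"

definition wdim :: "('i \<Rightarrow> nat) \<Rightarrow> ('i \<Rightarrow> 'k::field) set \<Rightarrow> ereal" where
  "wdim w C = krull_dim (subtopology (wproj_zariski w) (coarse_points w C))"


section \<open>The \<open>\<ell>\<close>-adic Euler characteristic\<close>

text \<open>
  Let \<open>Y \<subseteq> \<P>\<^sub>w\<close> be the projective variety with punctured cone \<open>C\<close> over an algebraically closed
  field. We define \<open>H\<^sup>i(Y, \<rat>\<^sub>\<ell>) = (lim\<^sub>k H\<^sup>i(Y\<^bsub>et\<^esub>, \<int>/\<ell>\<^sup>k)) \<otimes> \<rat>\<^sub>\<ell>\<close> with the etale cohomology groups on
  the right computed by Cech cochains, i.e. as the colimit over etale coverings. For projective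
  varieties this is etale cohomology (Artin).

  Every etale covering of \<open>Y\<close> is refined by a finite family of standard etale maps
  \<open>U = {(y, z) \<in> Y \<times> \<A>\<^sup>1. P(y, z) = 0, \<partial>P/\<partial>z(y, z) \<noteq> 0, g(y, z) \<noteq> 0} \<rightarrow> Y\<close>. Such a \<open>U\<close> is given by
  a pair \<open>(P, g)\<close> of polynomials in \<open>z\<close> whose coefficients are weighted homogeneous polynomials of
  one common degree on the cone (\<open>z\<close> has weight 0). No denominators are needed: where
  \<open>\<partial>P/\<partial>z \<noteq> 0\<close>, some coefficient of \<open>P\<close> does not vanish, and dividing \<open>P\<close> by it gives a polynomial
  over the local ring of \<open>Y\<close>. As \<open>U\<close> and the fibre products over \<open>Y\<close> of such maps are reduced,
  their \<open>'k\<close>-points suffice.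
\<close>

definition zpoly_at :: "('i, 'k::comm_ring_1) mpoly poly \<Rightarrow> ('i \<Rightarrow> 'k) \<Rightarrow> 'k poly" where
  "zpoly_at P x = map_poly (\<lambda>h. mp_eval h x) P"

definition zhomog :: "('i \<Rightarrow> nat) \<Rightarrow> nat \<Rightarrow> ('i, 'k::comm_ring_1) mpoly poly \<Rightarrow> bool" where
  "zhomog w d P \<longleftrightarrow> (\<forall>j. whomog w d (coeff P j))"

type_synonym ('i, 'k) etale_chart = "('i, 'k) mpoly poly \<times> ('i, 'k) mpoly poly"

definition in_chart :: "('i, 'k::field) etale_chart \<Rightarrow> ('i \<Rightarrow> 'k) \<Rightarrow> 'k \<Rightarrow> bool" where
  "in_chart U x z \<longleftrightarrow> poly (zpoly_at (fst U) x) z = 0 \<and>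
     poly (pderiv (zpoly_at (fst U) x)) z \<noteq> 0 \<and> poly (zpoly_at (snd U) x) z \<noteq> 0"

definition etale_cover ::
  "('i \<Rightarrow> nat) \<Rightarrow> ('i \<Rightarrow> 'k::field) set \<Rightarrow> ('i, 'k) etale_chart list \<Rightarrow> bool" where
  "etale_cover w C \<U> \<longleftrightarrow>
     (\<forall>U\<in>set \<U>. (\<exists>d. zhomog w d (fst U)) \<and> (\<exists>d. zhomog w d (snd U))) \<and>
     (\<forall>x\<in>C. \<exists>U\<in>set \<U>. \<exists>z. in_chart U x z)"

text \<open>Regular functions on \<open>U\<close>: locally fractions of the same degree.\<close>

definition regular_on_chart :: "('i \<Rightarrow> nat) \<Rightarrow> ('i \<Rightarrow> 'k::field) set \<Rightarrow>
    ('i, 'k) etale_chart \<Rightarrow> (('i \<Rightarrow> 'k) \<Rightarrow> 'k \<Rightarrow> 'k) \<Rightarrow> bool" where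
  "regular_on_chart w C U \<phi> \<longleftrightarrow> (\<forall>x\<in>C. \<forall>z. in_chart U x z \<longrightarrow>
     (\<exists>F G d. zhomog w d F \<and> zhomog w d G \<and> poly (zpoly_at G x) z \<noteq> 0 \<and>
       (\<forall>x'\<in>C. \<forall>z'. in_chart U x' z' \<and> poly (zpoly_at G x') z' \<noteq> 0 \<longrightarrow>
          \<phi> x' z' = poly (zpoly_at F x') z' / poly (zpoly_at G x') z')))"

text \<open>
  A refinement \<open>\<W> \<rightarrow> \<U>\<close> is a map \<open>\<sigma>\<close> of index sets together with morphisms
  \<open>(y, z) \<mapsto> (y, \<phi>\<^sub>a(y, z))\<close> over \<open>Y\<close> from the chart \<open>\<W>\<^sub>a\<close> to the chart \<open>\<U>\<^bsub>\<sigma>(a)\<^esub>\<close>.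
\<close>

definition cover_refinement :: "('i \<Rightarrow> nat) \<Rightarrow> ('i \<Rightarrow> 'k::field) set \<Rightarrow>
    ('i, 'k) etale_chart list \<Rightarrow> ('i, 'k) etale_chart list \<Rightarrow>
    (nat \<Rightarrow> nat) \<Rightarrow> (nat \<Rightarrow> ('i \<Rightarrow> 'k) \<Rightarrow> 'k \<Rightarrow> 'k) \<Rightarrow> bool" where
  "cover_refinement w C \<W> \<U> \<sigma> \<phi> \<longleftrightarrow> (\<forall>a<length \<W>. \<sigma> a < length \<U> \<and>
     regular_on_chart w C (\<W> ! a) (\<phi> a) \<and>
     (\<forall>x\<in>C. \<forall>z. in_chart (\<W> ! a) x z \<longrightarrow> in_chart (\<U> ! \<sigma> a) x (\<phi> a x z)))"

text \<open>
  A \<open>'k\<close>-point over \<open>[x]\<close> of the disjoint union of all fibre products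
  \<open>\<U>\<^bsub>a\<^sub>0\<^esub> \<times>\<^sub>Y \<dots> \<times>\<^sub>Y \<U>\<^bsub>a\<^sub>i\<^esub>\<close> is a list \<open>[(a\<^sub>0, z\<^sub>0), \<dots>, (a\<^sub>i, z\<^sub>i)]\<close>.
\<close>

definition cech_point :: "('i, 'k::field) etale_chart list \<Rightarrow> nat \<Rightarrow> ('i \<Rightarrow> 'k) \<Rightarrow>
    (nat \<times> 'k) list \<Rightarrow> bool" where
  "cech_point \<U> i x s \<longleftrightarrow> length s = Suc i \<and>
     (\<forall>(a, z)\<in>set s. a < length \<U> \<and> in_chart (\<U> ! a) x z)"

type_synonym ('i, 'k) cochain = "('i \<Rightarrow> 'k) \<Rightarrow> (nat \<times> 'k) list \<Rightarrow> int"

text \<open>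
  \<open>i\<close>-cochains with values in \<open>\<int>/N\<close> are the locally constant \<open>\<int>/N\<close>-valued functions on these fibre
  products, written with integer representatives. Local constancy is tested on the basic Zariski
  open sets \<open>{h \<noteq> 0}\<close> of \<open>Y \<times> \<A>\<^bsup>i+1\<^esup>\<close>, where \<open>h\<close> is weighted homogeneous in the cone coordinates
  \<open>Inl\<close> and the coordinates \<open>Inr j\<close>, standing for \<open>z\<^sub>j\<close>, have weight 0. These sets are
  \<open>\<G>\<^sub>m\<close>-stable, so a cochain only depends on \<open>[x]\<close>, modulo \<open>N\<close>.
\<close>

definition cone_coords :: "('i \<Rightarrow> 'k::field) \<Rightarrow> (nat \<times> 'k) list \<Rightarrow> ('i + nat \<Rightarrow> 'k)" where
  "cone_coords x s = case_sum x (\<lambda>j. if j < length s then snd (s ! j) else 0)"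

definition cech_cochain :: "('i \<Rightarrow> nat) \<Rightarrow> ('i \<Rightarrow> 'k::field) set \<Rightarrow> int \<Rightarrow>
    ('i, 'k) etale_chart list \<Rightarrow> nat \<Rightarrow> ('i, 'k) cochain \<Rightarrow> bool" where
  "cech_cochain w C N \<U> i c \<longleftrightarrow> (\<forall>x\<in>C. \<forall>s. cech_point \<U> i x s \<longrightarrow>
     (\<exists>h d. whomog (case_sum w (\<lambda>_. 0)) d h \<and> mp_eval h (cone_coords x s) \<noteq> 0 \<and>
       (\<forall>x'\<in>C. \<forall>s'. cech_point \<U> i x' s' \<and> map fst s' = map fst s \<and>
          mp_eval h (cone_coords x' s') \<noteq> 0 \<longrightarrow> [c x' s' = c x s] (mod N))))"

definition cech_diff :: "('i, 'k) cochain \<Rightarrow> ('i, 'k) cochain" where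
  "cech_diff c = (\<lambda>x s. \<Sum>j<length s. (-1) ^ j * c x (take j s @ drop (Suc j) s))"

definition cech_cocycle :: "('i \<Rightarrow> nat) \<Rightarrow> ('i \<Rightarrow> 'k::field) set \<Rightarrow> int \<Rightarrow>
    ('i, 'k) etale_chart list \<Rightarrow> nat \<Rightarrow> ('i, 'k) cochain \<Rightarrow> bool" where
  "cech_cocycle w C N \<U> i c \<longleftrightarrow> cech_cochain w C N \<U> i c \<and>
     (\<forall>x\<in>C. \<forall>s. cech_point \<U> (Suc i) x s \<longrightarrow> [cech_diff c x s = 0] (mod N))"

text \<open>The Cech complex is not augmented, so a coboundary of degree 0 is zero.\<close>

definition cech_coboundary :: "('i \<Rightarrow> nat) \<Rightarrow> ('i \<Rightarrow> 'k::field) set \<Rightarrow> int \<Rightarrow>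
    ('i, 'k) etale_chart list \<Rightarrow> nat \<Rightarrow> ('i, 'k) cochain \<Rightarrow> bool" where
  "cech_coboundary w C N \<U> i c \<longleftrightarrow> (\<exists>b. (i > 0 \<longrightarrow> cech_cochain w C N \<U> (i - 1) b) \<and>
     (\<forall>x\<in>C. \<forall>s. cech_point \<U> i x s \<longrightarrow>
        [c x s = (if i = 0 then 0 else cech_diff b x s)] (mod N)))"

definition cochain_pullback :: "(nat \<Rightarrow> nat) \<Rightarrow> (nat \<Rightarrow> ('i \<Rightarrow> 'k) \<Rightarrow> 'k \<Rightarrow> 'k) \<Rightarrow>
    ('i, 'k) cochain \<Rightarrow> ('i, 'k) cochain" where
  "cochain_pullback \<sigma> \<phi> c = (\<lambda>x s. c x (map (\<lambda>(a, z). (\<sigma> a, \<phi> a x z)) s))"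

text \<open>
  An element of \<open>H\<^sup>i(Y\<^bsub>et\<^esub>, \<int>/N)\<close> is represented by a cover with a cocycle on it. The relation
  \<open>\<Sum>\<^sub>j a\<^sub>j [m\<^sub>j] = 0\<close> holds in the colimit iff the combination of the pullbacks to some common
  refinement is a coboundary.
\<close>

type_synonym ('i, 'k) cech_rep = "('i, 'k) etale_chart list \<times> ('i, 'k) cochain"

definition etale_class_rep :: "('i \<Rightarrow> nat) \<Rightarrow> ('i \<Rightarrow> 'k::field) set \<Rightarrow> int \<Rightarrow> nat \<Rightarrow>
    ('i, 'k) cech_rep \<Rightarrow> bool" where
  "etale_class_rep w C N i m \<longleftrightarrow> etale_cover w C (fst m) \<and> cech_cocycle w C N (fst m) i (snd m)"

definition etale_relation :: "('i \<Rightarrow> nat) \<Rightarrow> ('i \<Rightarrow> 'k::field) set \<Rightarrow> int \<Rightarrow> nat \<Rightarrow>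
    int list \<Rightarrow> ('i, 'k) cech_rep list \<Rightarrow> bool" where
  "etale_relation w C N i as ms \<longleftrightarrow> (\<exists>\<W> \<sigma> \<phi>. etale_cover w C \<W> \<and>
     (\<forall>j<length ms. cover_refinement w C \<W> (fst (ms ! j)) (\<sigma> j) (\<phi> j)) \<and>
     cech_coboundary w C N \<W> i
       (\<lambda>x s. \<Sum>j<length ms. as ! j * cochain_pullback (\<sigma> j) (\<phi> j) (snd (ms ! j)) x s))"

text \<open>Elements of \<open>lim\<^sub>k H\<^sup>i(Y\<^bsub>et\<^esub>, \<int>/\<ell>\<^sup>k)\<close> and of \<open>\<int>\<^sub>\<ell> = lim\<^sub>k \<int>/\<ell>\<^sup>k\<close>, as compatible sequences.\<close>

definition ladic_class :: "('i \<Rightarrow> nat) \<Rightarrow> ('i \<Rightarrow> 'k::field) set \<Rightarrow> nat \<Rightarrow> nat \<Rightarrow>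
    (nat \<Rightarrow> ('i, 'k) cech_rep) \<Rightarrow> bool" where
  "ladic_class w C l i m \<longleftrightarrow> (\<forall>k. etale_class_rep w C (int l ^ k) i (m k)) \<and>
     (\<forall>k. etale_relation w C (int l ^ k) i [1, -1] [m (Suc k), m k])"

definition ladic_int :: "nat \<Rightarrow> (nat \<Rightarrow> int) \<Rightarrow> bool" where
  "ladic_int l a \<longleftrightarrow> (\<forall>k. [a (Suc k) = a k] (mod int l ^ k))"

definition ladic_zero :: "nat \<Rightarrow> (nat \<Rightarrow> int) \<Rightarrow> bool" where
  "ladic_zero l a \<longleftrightarrow> (\<forall>k. [a k = 0] (mod int l ^ k))"

definition ladic_independent :: "('i \<Rightarrow> nat) \<Rightarrow> ('i \<Rightarrow> 'k::field) set \<Rightarrow> nat \<Rightarrow> nat \<Rightarrow>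
    (nat \<Rightarrow> ('i, 'k) cech_rep) list \<Rightarrow> bool" where
  "ladic_independent w C l i ms \<longleftrightarrow> (\<forall>as. length as = length ms \<and>
     (\<forall>a\<in>set as. ladic_int l a) \<and>
     (\<forall>k. etale_relation w C (int l ^ k) i (map (\<lambda>a. a k) as) (map (\<lambda>m. m k) ms))
     \<longrightarrow> (\<forall>a\<in>set as. ladic_zero l a))"

text \<open>
  The dimension of \<open>M \<otimes> \<rat>\<^sub>\<ell>\<close> is the largest size of a \<open>\<int>\<^sub>\<ell>\<close>-linearly independent family in \<open>M\<close>.
\<close>

definition ladic_betti :: "('i \<Rightarrow> nat) \<Rightarrow> ('i \<Rightarrow> 'k::field) set \<Rightarrow> nat \<Rightarrow> nat \<Rightarrow> nat" where
  "ladic_betti w C l i = Max {length ms |ms.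
     (\<forall>m\<in>set ms. ladic_class w C l i m) \<and> ladic_independent w C l i ms}"

definition euler_char :: "('i \<Rightarrow> nat) \<Rightarrow> nat \<Rightarrow> ('i \<Rightarrow> 'k::field) set \<Rightarrow> int" where
  "euler_char w l C =
     (\<Sum>i | ladic_betti w C l i \<noteq> 0. (-1) ^ i * int (ladic_betti w C l i))"


section \<open>Zeta functions\<close>

definition zeta_series :: "(nat \<Rightarrow> real) \<Rightarrow> real fps" where
  "zeta_series a = fps_compose (fps_exp 1) (Abs_fps (\<lambda>r. if r = 0 then 0 else a r / real r))"

text \<open>
  \<open>Z\<close> is (the expansion of) a rational function \<open>A/B\<close> satisfying
  \<open>Z(1/(Q\<^sup>\<delta> t)) = \<plusminus> Q\<^bsup>\<delta>N/2\<^esup> t\<^sup>N Z(t)\<close>. The identity of rational functions is expressed as equality of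
  values at all but finitely many real \<open>t\<close>.
\<close>

definition functional_equation :: "real fps \<Rightarrow> nat \<Rightarrow> nat \<Rightarrow> int \<Rightarrow> bool" where
  "functional_equation Z Q \<delta> N \<longleftrightarrow>
     (\<exists>(A :: real poly) (B :: real poly). B \<noteq> 0 \<and> Z * fps_of_poly B = fps_of_poly A \<and>
       (\<exists>\<epsilon>\<in>{1, -1}. \<forall>t. t \<noteq> 0 \<and> poly B t \<noteq> 0 \<and> poly B (1 / (real Q ^ \<delta> * t)) \<noteq> 0 \<longrightarrow>
          poly A (1 / (real Q ^ \<delta> * t)) / poly B (1 / (real Q ^ \<delta> * t)) =
          \<epsilon> * (real Q powr (real \<delta> * of_int N / 2)) * (t powi N) * (poly A t / poly B t)))"

text \<open>
  For \<open>Y\<close> defined over \<open>\<F>\<^sub>Q\<close>, the set \<open>Y(\<F>\<^sub>Q)\<close> consists of the Frobenius-fixed geometric points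
  of the coarse variety.
\<close>

definition frob :: "nat \<Rightarrow> ('i \<Rightarrow> 'k::field) \<Rightarrow> ('i \<Rightarrow> 'k)" where
  "frob Q x = (\<lambda>i. x i ^ Q)"

definition rational_points ::
  "('i \<Rightarrow> nat) \<Rightarrow> ('i \<Rightarrow> 'k::field) set \<Rightarrow> nat \<Rightarrow> ('i \<Rightarrow> 'k) set set" where
  "rational_points w C Q = {y \<in> coarse_points w C. frob Q ` y = y}"

definition hasse_weil_zeta :: "('i \<Rightarrow> nat) \<Rightarrow> ('i \<Rightarrow> 'k::field) set \<Rightarrow> nat \<Rightarrow> real fps" where
  "hasse_weil_zeta w C Q = zeta_series (\<lambda>m. real (card (rational_points w C (Q ^ m))))"

text \<open>The variety over \<open>\<F>\<^sub>Q\<close> with (geometric) punctured cone \<open>C\<close> is self-dual.\<close>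

definition self_dual :: "nat \<Rightarrow> ('i \<Rightarrow> nat) \<Rightarrow> ('i \<Rightarrow> 'k::field) set \<Rightarrow> nat \<Rightarrow> bool" where
  "self_dual l w C Q \<longleftrightarrow> (\<exists>d. wdim w C = ereal (real d) \<and>
     functional_equation (hasse_weil_zeta w C Q) Q d (euler_char w l C))"

definition orbit_support :: "('i \<Rightarrow> 'k::field) set \<Rightarrow> 'i set" where
  "orbit_support y = {i. \<exists>x\<in>y. x i \<noteq> 0}"

definition stab_gcd :: "('i \<Rightarrow> nat) \<Rightarrow> ('i \<Rightarrow> 'k::field) set \<Rightarrow> nat \<Rightarrow> nat" where
  "stab_gcd w y Q = gcd (Gcd (w ` orbit_support y)) (Q - 1)"

definition Theta :: "('i \<Rightarrow> nat) \<Rightarrow> ('i \<Rightarrow> 'k::field) set \<Rightarrow> nat \<Rightarrow> int \<Rightarrow> nat \<Rightarrow> real" where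
  "Theta w C q s r = (\<Sum>y\<in>rational_points w C (q ^ r). real (stab_gcd w y (q ^ r)) powi (1 - s))"

definition Zcan :: "('i \<Rightarrow> nat) \<Rightarrow> ('i \<Rightarrow> 'k::field) set \<Rightarrow> nat \<Rightarrow> int \<Rightarrow> real fps" where
  "Zcan w C q s = zeta_series (Theta w C q s)"

text \<open>
  Since \<open>\<G>\<^sub>m\<close>-torsors over a field are trivial, the groupoid of \<open>\<F>\<^sub>Q\<close>-points of the quotient stack
  \<open>[C/\<G>\<^sub>m]\<close> is the action groupoid of \<open>\<F>\<^sub>Q\<^sup>\<times>\<close> on the set of vectors of \<open>C\<close> with coordinates
  in \<open>\<F>\<^sub>Q = {c. c\<^sup>Q = c}\<close>.
\<close>

definition stack_objects :: "('i \<Rightarrow> 'k::field) set \<Rightarrow> nat \<Rightarrow> ('i \<Rightarrow> 'k) set" where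
  "stack_objects C Q = {x \<in> C. \<forall>i. x i ^ Q = x i}"

definition stack_iso ::
  "('i \<Rightarrow> nat) \<Rightarrow> ('i \<Rightarrow> 'k::field) set \<Rightarrow> nat \<Rightarrow> (('i \<Rightarrow> 'k) \<times> ('i \<Rightarrow> 'k)) set" where
  "stack_iso w C Q = {(x, y). x \<in> stack_objects C Q \<and> y \<in> stack_objects C Q \<and>
     (\<exists>c. c \<noteq> 0 \<and> c ^ Q = c \<and> y = wscale w c x)}"

definition stack_pi0 ::
  "('i \<Rightarrow> nat) \<Rightarrow> ('i \<Rightarrow> 'k::field) set \<Rightarrow> nat \<Rightarrow> ('i \<Rightarrow> 'k) set set" where
  "stack_pi0 w C Q = stack_objects C Q // stack_iso w C Q"

definition Ztw :: "('i \<Rightarrow> nat) \<Rightarrow> ('i \<Rightarrow> 'k::field) set \<Rightarrow> nat \<Rightarrow> real fps" where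
  "Ztw w C q = zeta_series (\<lambda>r. real (card (stack_pi0 w C (q ^ r))))"


section \<open>Weighted hypersurfaces and their sectors\<close>

text \<open>Geometric punctured cone of \<open>V(f)\<close>, for \<open>f\<close> with coefficients in the finite field \<open>'a\<close>.\<close>

definition hypersurface_cone ::
  "('i, 'a::field) mpoly \<Rightarrow> ('i \<Rightarrow> 'a alg_closure) set" where
  "hypersurface_cone f = {x. x \<noteq> (\<lambda>_. 0) \<and> mp_eval (Poly_Mapping.map to_ac f) x = 0}"

definition sector_cone ::
  "('i \<Rightarrow> nat) \<Rightarrow> ('i, 'a::field) mpoly \<Rightarrow> nat \<Rightarrow> ('i \<Rightarrow> 'a alg_closure) set" where
  "sector_cone w f e = {x \<in> hypersurface_cone f. \<forall>i. \<not> e dvd w i \<longrightarrow> x i = 0}"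

definition sector_indices :: "nat \<Rightarrow> ('i \<Rightarrow> nat) \<Rightarrow> nat set" where
  "sector_indices p w = {e. e \<ge> 1 \<and> coprime e p \<and> (\<exists>i. e dvd w i)}"

definition moebius :: "nat \<Rightarrow> int" where
  "moebius m = (if squarefree m then (-1) ^ card (prime_factors m) else 0)"

definition jordan_totient :: "nat \<Rightarrow> nat \<Rightarrow> int" where
  "jordan_totient k e = (\<Sum>d | d dvd e. moebius (e div d) * int d ^ k)"

end

theory Submission
  imports Defs "HOL-Algebra.Sylow"
begin

text \<open>
  The idea is to write the canonical zeta function as a product of powers of zeta functions of
  sectors, and to check that in each factor the field extension, over which a sector is
  self-dual, cancels against the exponent.

  Over \<open>\<F>\<^sub>Q\<close> with \<open>Q = q ^ r\<close>, a point with stabiliser order \<open>g\<close> contributes \<open>g ^ k\<close> to \<open>\<Theta>\<^sub>r(s)\<close>,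
  where \<open>k = 1 - s\<close>. Moebius inversion gives \<open>g ^ k = \<Sum> J\<^sub>k(e)\<close>, the sum being over the
  divisors \<open>e\<close> of \<open>g\<close>. As \<open>g\<close> is the greatest common divisor of \<open>Q - 1\<close> and the weights of the nonzero
  coordinates, \<open>e\<close> divides \<open>g\<close> iff \<open>e\<close> divides \<open>Q - 1\<close> and the point lies in the sector \<open>X\<^sup>(\<^sup>e\<^sup>)\<close>;
  and \<open>e\<close> divides \<open>q ^ r - 1\<close> iff the order \<open>o\<close> of \<open>q\<close> modulo \<open>e\<close> divides \<open>r\<close>. Summing
  over the points therefore gives a sum of terms \<open>J\<^sub>k(e) #X\<^sup>(\<^sup>e\<^sup>)(\<F>\<^sub>Q)\<close> in degrees \<open>r\<close> divisible by \<open>o\<close>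
  (lemma \<open>Theta_eq_sum_sectors\<close>). After exponentiation, this is the product over \<open>e\<close> of
  \<open>Z(X\<^sup>(\<^sup>e\<^sup>) \<otimes> \<F>, t ^ o)\<close> raised to the power \<open>J\<^sub>k(e) / o\<close>, with \<open>\<F>\<close> the extension of degree \<open>o\<close>
  (lemma \<open>Zcan_eq_prod_sectors\<close>).

  The exponent is a natural number: \<open>\<phi>(e)\<close> divides \<open>J\<^sub>k(e)\<close> for \<open>k > 0\<close>, and \<open>o\<close> divides \<open>\<phi>(e)\<close>. This also
  gives the rationality that a functional equation presupposes. The substitution of \<open>t ^ o\<close>
  turns a functional equation over the extension of degree \<open>o\<close>, with exponent \<open>\<chi>\<close>, into one over \<open>\<F>\<^sub>q\<close>
  with exponent \<open>o \<chi>\<close>, and the power \<open>J\<^sub>k(e) / o\<close> of it has exponent \<open>J\<^sub>k(e) \<chi>\<close>. All sectors have the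
  same dimension \<open>\<delta>\<close>, so these equations can be multiplied, and the exponents add up to \<open>N\<^sub>s\<close>. Empty sectors
  contribute the factor 1 and have \<open>\<chi> = 0\<close>.

  For the twisted zeta function, the isomorphism classes of the groupoid \<open>\<XX>(\<F>\<^sub>Q)\<close> over a point with
  stabiliser order \<open>g\<close> number exactly \<open>g\<close> (lemma \<open>card_stack_pi0\<close>), so that it is the canonical one at \<open>s = 0\<close>;
  and \<open>J\<^sub>1 = \<phi>\<close>.
\<close>


section \<open>Functional equations under products, powers and dilation\<close>

lemma functional_equation_one: "functional_equation 1 Q \<delta> 0" if "Q > 0"
  unfolding functional_equation_def
  by (rule exI[of _ 1], rule exI[of _ 1]) (use that in auto)

text \<open>
  The exponents may be added only because both factors have the same \<open>Q\<close> and the same \<open>\<delta>\<close>, hence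
  the same involution of the \<open>t\<close>-line.
\<close>

lemma functional_equation_mult:
  assumes Q: "Q > 0"
    and Y: "functional_equation Y Q \<delta> M" and Z: "functional_equation Z Q \<delta> N"
  shows "functional_equation (Y * Z) Q \<delta> (M + N)"
proof -
  from Y obtain A B \<epsilon> where B: "B \<noteq> 0" "Y * fps_of_poly B = fps_of_poly A" "\<epsilon> \<in> {1, -1}"
    and A: "\<And>t. t \<noteq> 0 \<and> poly B t \<noteq> 0 \<and> poly B (1 / (real Q ^ \<delta> * t)) \<noteq> 0 \<Longrightarrow>
      poly A (1 / (real Q ^ \<delta> * t)) / poly B (1 / (real Q ^ \<delta> * t)) =
      \<epsilon> * (real Q powr (real \<delta> * of_int M / 2)) * (t powi M) * (poly A t / poly B t)"
    unfolding functional_equation_def by metis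
  from Z obtain C D \<eta> where D: "D \<noteq> 0" "Z * fps_of_poly D = fps_of_poly C" "\<eta> \<in> {1, -1}"
    and C: "\<And>t. t \<noteq> 0 \<and> poly D t \<noteq> 0 \<and> poly D (1 / (real Q ^ \<delta> * t)) \<noteq> 0 \<Longrightarrow>
      poly C (1 / (real Q ^ \<delta> * t)) / poly D (1 / (real Q ^ \<delta> * t)) =
      \<eta> * (real Q powr (real \<delta> * of_int N / 2)) * (t powi N) * (poly C t / poly D t)"
    unfolding functional_equation_def by metis
  show ?thesis
    unfolding functional_equation_def
  proof (intro exI conjI bexI allI impI)
    show "B * D \<noteq> 0" using B D by simp
    have "Y * Z * fps_of_poly (B * D) = (Y * fps_of_poly B) * (Z * fps_of_poly D)"
      by (simp add: fps_of_poly_mult mult_ac)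
    then show "Y * Z * fps_of_poly (B * D) = fps_of_poly (A * C)"
      by (simp add: B D fps_of_poly_mult)
    show "\<epsilon> * \<eta> \<in> {1, -1}" using B D by auto
  next
    fix t assume t: "t \<noteq> 0 \<and> poly (B * D) t \<noteq> 0 \<and> poly (B * D) (1 / (real Q ^ \<delta> * t)) \<noteq> 0"
    have "real Q powr (real \<delta> * of_int (M + N) / 2) =
        real Q powr (real \<delta> * of_int M / 2) * real Q powr (real \<delta> * of_int N / 2)"
      by (simp add: powr_add [symmetric] algebra_simps add_divide_distrib)
    moreover have "t powi (M + N) = t powi M * t powi N"
      using t by (simp add: power_int_add)
    ultimately have split: "\<epsilon> * \<eta> * (real Q powr (real \<delta> * of_int (M + N) / 2)) * (t powi (M + N)) *
        (poly (A * C) t / poly (B * D) t) =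
        (\<epsilon> * (real Q powr (real \<delta> * of_int M / 2)) * (t powi M) * (poly A t / poly B t)) *
        (\<eta> * (real Q powr (real \<delta> * of_int N / 2)) * (t powi N) * (poly C t / poly D t))"
      by (simp add: mult_ac)
    have "poly A (1 / (real Q ^ \<delta> * t)) / poly B (1 / (real Q ^ \<delta> * t)) =
        \<epsilon> * (real Q powr (real \<delta> * of_int M / 2)) * (t powi M) * (poly A t / poly B t)"
      by (rule A) (use t in auto)
    moreover have "poly C (1 / (real Q ^ \<delta> * t)) / poly D (1 / (real Q ^ \<delta> * t)) =
        \<eta> * (real Q powr (real \<delta> * of_int N / 2)) * (t powi N) * (poly C t / poly D t)"
      by (rule C) (use t in auto)
    ultimately show "poly (A * C) (1 / (real Q ^ \<delta> * t)) / poly (B * D) (1 / (real Q ^ \<delta> * t)) =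
        \<epsilon> * \<eta> * (real Q powr (real \<delta> * of_int (M + N) / 2)) * (t powi (M + N)) *
        (poly (A * C) t / poly (B * D) t)"
      unfolding split by (simp only: poly_mult times_divide_times_eq [symmetric])
  qed
qed

lemma functional_equation_power:
  assumes "Q > 0" "functional_equation Z Q \<delta> N"
  shows "functional_equation (Z ^ n) Q \<delta> (int n * N)"
proof (induction n)
  case 0
  then show ?case using assms by (simp add: functional_equation_one)
next
  case (Suc n)
  then show ?case
    using functional_equation_mult[OF assms(1,2) Suc] by (simp add: algebra_simps)
qed

lemma functional_equation_prod:
  assumes "Q > 0" "finite E" "\<And>e. e \<in> E \<Longrightarrow> functional_equation (Z e) Q \<delta> (N e)"
  shows "functional_equation (\<Prod>e\<in>E. Z e) Q \<delta> (\<Sum>e\<in>E. N e)"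
  using assms(2,3)
  by (induction E rule: finite_induct)
     (simp_all add: functional_equation_one functional_equation_mult \<open>Q > 0\<close>)

text \<open>
  Passing from \<open>t\<close> to \<open>t ^ k\<close> carries the involution for \<open>q\<close> to the one for \<open>q ^ k\<close>, and
  both \<open>(q ^ k) ^ (\<delta> N / 2)\<close> and \<open>(t ^ k) ^ N\<close> absorb the factor \<open>k\<close> into the exponent \<open>N\<close>.
\<close>

lemma functional_equation_dilate:
  assumes q: "q > 0" and k: "k > 0" and Z: "functional_equation Z (q ^ k) \<delta> N"
  shows "functional_equation (Z oo fps_X ^ k) q \<delta> (int k * N)"
proof -
  from Z obtain A B \<epsilon> where B: "B \<noteq> 0" "Z * fps_of_poly B = fps_of_poly A" "\<epsilon> \<in> {1, -1}"
    and A: "\<And>t. t \<noteq> 0 \<and> poly B t \<noteq> 0 \<and> poly B (1 / (real (q ^ k) ^ \<delta> * t)) \<noteq> 0 \<Longrightarrow>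
      poly A (1 / (real (q ^ k) ^ \<delta> * t)) / poly B (1 / (real (q ^ k) ^ \<delta> * t)) =
      \<epsilon> * (real (q ^ k) powr (real \<delta> * of_int N / 2)) * (t powi N) * (poly A t / poly B t)"
    unfolding functional_equation_def by metis
  let ?m = "monom 1 k :: real poly"
  have m: "coeff ?m 0 = 0" "degree ?m > 0" "fps_of_poly ?m = fps_X ^ k"
    using k by (simp_all add: degree_monom_eq fps_of_poly_monom)
  have poly_m: "poly (pcompose P ?m) t = poly P (t ^ k)" for P t
    by (simp add: poly_pcompose poly_monom)
  show ?thesis
    unfolding functional_equation_def
  proof (intro exI conjI bexI allI impI)
    show "pcompose B ?m \<noteq> 0" using B m pcompose_eq_0 by blast
    have "(Z oo fps_X ^ k) * fps_of_poly (pcompose B ?m) = (Z * fps_of_poly B) oo fps_X ^ k"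
      using k by (simp add: fps_of_poly_pcompose m fps_compose_mult_distrib)
    also have "\<dots> = fps_of_poly (pcompose A ?m)"
      unfolding B by (simp only: fps_of_poly_pcompose[OF m(1)] m(3))
    finally show "(Z oo fps_X ^ k) * fps_of_poly (pcompose B ?m) = fps_of_poly (pcompose A ?m)" .
    show "\<epsilon> \<in> {1, -1}" by fact
  next
    fix t assume t: "t \<noteq> 0 \<and> poly (pcompose B ?m) t \<noteq> 0 \<and>
      poly (pcompose B ?m) (1 / (real q ^ \<delta> * t)) \<noteq> 0"
    have inv: "(1 / (real q ^ \<delta> * t)) ^ k = 1 / (real (q ^ k) ^ \<delta> * t ^ k)"
      by (simp add: power_divide power_mult_distrib power_mult [symmetric] mult.commute)
    have "real (q ^ k) powr (real \<delta> * of_int N / 2) = real q powr (real \<delta> * of_int (int k * N) / 2)"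
      using q by (simp add: powr_powr powr_realpow [symmetric] algebra_simps)
    moreover have "(t ^ k) powi N = t powi (int k * N)"
      by (simp add: power_int_mult)
    ultimately show "poly (pcompose A ?m) (1 / (real q ^ \<delta> * t)) /
        poly (pcompose B ?m) (1 / (real q ^ \<delta> * t)) =
        \<epsilon> * (real q powr (real \<delta> * of_int (int k * N) / 2)) * (t powi (int k * N)) *
        (poly (pcompose A ?m) t / poly (pcompose B ?m) t)"
      using A[of "t ^ k"] t unfolding poly_m inv by simp
  qed
qed


section \<open>Exponential generating series of point counts\<close>

text \<open>
  The identities for exponentials below are checked on logarithmic derivatives: the \<open>n\<close>-th
  coefficient of a solution determines the next one, since \<open>n + 1\<close> is invertible.
\<close>

lemma fps_linear_ode_unique:
  fixes F G h :: "real fps"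
  assumes "fps_deriv F = F * h" "fps_deriv G = G * h" "fps_nth F 0 = fps_nth G 0"
  shows "F = G"
proof -
  have "fps_nth F n = fps_nth G n" for n
  proof (induction n rule: less_induct)
    case (less n)
    show ?case
    proof (cases n)
      case 0
      then show ?thesis using assms(3) by simp
    next
      case (Suc m)
      have "real (Suc m) * fps_nth F (Suc m) = fps_nth (F * h) m"
        unfolding assms(1) [symmetric] by simp
      also have "\<dots> = fps_nth (G * h) m"
        unfolding fps_mult_nth using less Suc by (intro sum.cong) auto
      also have "\<dots> = real (Suc m) * fps_nth G (Suc m)"
        unfolding assms(2) [symmetric] by simp
      finally show ?thesis using Suc by simp
    qed
  qed
  then show ?thesis by (simp add: fps_eq_iff)
qed

lemma zeta_series_nth_0: "fps_nth (zeta_series a) 0 = 1"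
  by (simp add: zeta_series_def)

lemma fps_deriv_zeta_series:
  "fps_deriv (zeta_series a) = zeta_series a * Abs_fps (\<lambda>n. a (Suc n))"
proof -
  let ?L = "Abs_fps (\<lambda>r. if r = 0 then 0 else a r / real r)"
  have "fps_deriv ?L = Abs_fps (\<lambda>n. a (Suc n))"
    by (simp add: fps_eq_iff del: of_nat_Suc)
  then show ?thesis
    unfolding zeta_series_def by (subst fps_compose_deriv) simp_all
qed

lemma zeta_series_cong:
  assumes "\<And>r. r > 0 \<Longrightarrow> a r = b r"
  shows "zeta_series a = zeta_series b"
proof -
  have "(\<lambda>r. if r = 0 then 0 else a r / real r) = (\<lambda>r. if r = 0 then 0 else b r / real r)"
    using assms by auto
  then show ?thesis by (simp add: zeta_series_def)
qed

lemma zeta_series_0: "zeta_series (\<lambda>_. 0) = 1"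
proof -
  have "(\<lambda>r :: nat. if r = 0 then 0 else 0 / real r) = (\<lambda>_. 0)" by auto
  then show ?thesis by (simp add: zeta_series_def fps_zero_def [symmetric])
qed

lemma zeta_series_add: "zeta_series (\<lambda>r. a r + b r) = zeta_series a * zeta_series b"
proof (rule fps_linear_ode_unique)
  let ?h = "Abs_fps (\<lambda>n. a (Suc n) + b (Suc n))"
  have h: "?h = Abs_fps (\<lambda>n. a (Suc n)) + Abs_fps (\<lambda>n. b (Suc n))"
    by (simp add: fps_eq_iff)
  show "fps_deriv (zeta_series (\<lambda>r. a r + b r)) = zeta_series (\<lambda>r. a r + b r) * ?h"
    by (rule fps_deriv_zeta_series)
  show "fps_deriv (zeta_series a * zeta_series b) = zeta_series a * zeta_series b * ?h"
    unfolding h by (simp add: fps_deriv_zeta_series algebra_simps)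
qed (simp add: zeta_series_nth_0)

lemma zeta_series_scale: "zeta_series (\<lambda>r. real n * a r) = zeta_series a ^ n"
  by (induction n) (simp_all add: zeta_series_0 zeta_series_add algebra_simps)

lemma zeta_series_sum:
  assumes "finite E"
  shows "zeta_series (\<lambda>r. \<Sum>e\<in>E. a e r) = (\<Prod>e\<in>E. zeta_series (a e))"
  using assms by (induction E rule: finite_induct) (simp_all add: zeta_series_0 zeta_series_add)

text \<open>
  The counts \<open>b\<close> of a variety over the extension of degree \<open>k\<close> belong to the degrees \<open>r\<close> divisible
  by \<open>k\<close> over the base field. There \<open>b (r div k)\<close> has the denominator \<open>r / k\<close> instead of \<open>r\<close>, whence
  the factor \<open>k\<close>.
\<close>

lemma zeta_series_dilate:
  assumes k: "k > 0"
  shows "zeta_series (\<lambda>r. if k dvd r then real k * b (r div k) else 0) =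
    zeta_series b oo fps_X ^ k"
proof -
  let ?L = "\<lambda>a. Abs_fps (\<lambda>r. if r = 0 then 0 else a r / real r)"
  have "fps_nth (?L b oo fps_X ^ k) n =
      fps_nth (?L (\<lambda>r. if k dvd r then real k * b (r div k) else 0)) n" for n
  proof -
    have "fps_nth (?L b oo fps_X ^ k) n =
        (\<Sum>i = 0..n. if n = k * i then fps_nth (?L b) i else 0)"
      unfolding fps_compose_nth power_mult [symmetric] fps_X_power_nth by (intro sum.cong) auto
    also have "\<dots> = (if k dvd n then fps_nth (?L b) (n div k) else 0)"
    proof (cases "k dvd n")
      case True
      then obtain m where m: "n = k * m" by blast
      then have "(\<Sum>i = 0..n. if n = k * i then fps_nth (?L b) i else 0) =
          (\<Sum>i = 0..n. if i = m then fps_nth (?L b) i else 0)"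
        using k by (intro sum.cong) auto
      then show ?thesis using m k by simp
    qed (auto intro!: sum.neutral)
    also have "\<dots> = fps_nth (?L (\<lambda>r. if k dvd r then real k * b (r div k) else 0)) n"
      using k by (auto simp: field_simps elim!: dvdE)
    finally show ?thesis .
  qed
  then have "?L b oo fps_X ^ k = ?L (\<lambda>r. if k dvd r then real k * b (r div k) else 0)"
    by (simp add: fps_eq_iff)
  then show ?thesis
    unfolding zeta_series_def using k by (subst fps_compose_assoc [symmetric]) simp_all
qed


section \<open>The Jordan totient\<close>

text \<open>
  Arithmetic functions such as \<open>J\<^sub>k\<close> are multiplicative, so their properties follow by splitting
  off the whole power of one prime at a time.
\<close>

lemma prime_power_times_coprime_induct [consumes 1, case_names one prime_power]:
  fixes n :: nat
  assumes n: "n > 0" and one: "P 1"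
    and step: "\<And>p a m. Factorial_Ring.prime p \<Longrightarrow> \<not> p dvd m \<Longrightarrow> m > 0 \<Longrightarrow> P m \<Longrightarrow> P (p ^ Suc a * m)"
  shows "P n"
  using n
proof (induction n rule: less_induct)
  case (less n)
  show ?case
  proof (cases "n = 1")
    case False
    then obtain p where p: "Factorial_Ring.prime p" "p dvd n"
      using prime_factor_nat by blast
    obtain m where m: "n = p ^ multiplicity p n * m" "\<not> p dvd m"
      using multiplicity_decompose'[of n p] less.prems p not_prime_unit by (metis neq0_conv)
    have "multiplicity p n \<noteq> 0"
      using p(2) m by (metis mult_1 power_0)
    then obtain a where a: "n = p ^ Suc a * m"
      using m(1) not0_implies_Suc by metis
    have "m > 0" using less.prems a by (cases m) auto
    moreover have "m < n"
    proof -
      have "1 < p ^ Suc a" using p(1) prime_gt_1_nat one_less_power by blast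
      then show ?thesis using a \<open>m > 0\<close> by simp
    qed
    ultimately show ?thesis
      using step[OF p(1) m(2)] less.IH a by blast
  qed (use one in simp)
qed

text \<open>
  Only divisors \<open>c\<close> without a square factor count. Those of \<open>p ^ Suc a * m\<close> are the ones of \<open>m\<close> and their
  products with \<open>p\<close>, and multiplication by \<open>p\<close> changes the sign of \<open>\<mu>\<close>.
\<close>

lemma sum_moebius_prime_power:
  fixes F :: "nat \<Rightarrow> int"
  assumes p: "Factorial_Ring.prime p" "\<not> p dvd m" and m: "m > 0"
  shows "(\<Sum>c | c dvd p ^ Suc a * m. moebius c * F c) =
    (\<Sum>c | c dvd m. moebius c * (F c - F (p * c)))"
proof -
  have fin: "finite {c. c dvd p ^ Suc a * m}"
    using p m by (simp add: prime_gt_0_nat)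
  have "p \<noteq> 0" using p by auto
  have sub: "{c. c dvd m} \<union> (*) p ` {c. c dvd m} \<subseteq> {c. c dvd p ^ Suc a * m}"
    by (auto intro: mult_dvd_mono)
  have zero: "moebius c = 0"
    if "c dvd p ^ Suc a * m" "\<not> c dvd m" "c \<notin> (*) p ` {c. c dvd m}" for c
  proof (rule ccontr)
    assume "moebius c \<noteq> 0"
    then have sqf: "squarefree c" by (auto simp: moebius_def split: if_splits)
    show False
    proof (cases "p dvd c")
      case True
      then obtain c' where c': "c = p * c'" by blast
      have "\<not> p dvd c'"
      proof
        assume "p dvd c'"
        then have "p ^ 2 dvd c" by (auto simp: c' power2_eq_square)
        then have "p dvd 1" using sqf squarefreeD by blast
        then show False using p by simp
      qed
      then have "coprime c' (p ^ Suc a)"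
        using p prime_imp_coprime coprime_commute coprime_power_right_iff by metis
      moreover have "c' dvd p ^ Suc a * m" using that(1) c' by (metis dvd_mult_right)
      ultimately have "c' dvd m" using coprime_dvd_mult_right_iff by blast
      then show False using that(3) c' by auto
    next
      case False
      then have "coprime c (p ^ Suc a)"
        using p prime_imp_coprime coprime_commute coprime_power_right_iff by metis
      then show False using that(1,2) coprime_dvd_mult_right_iff by blast
    qed
  qed
  have moebius_p: "moebius (p * c) = - moebius c" if "c dvd m" for c
  proof -
    have c: "\<not> p dvd c" "c \<noteq> 0" using that p m by (auto dest: dvd_trans)
    then have "coprime p c" using p prime_imp_coprime by blast
    moreover have "squarefree p" using p by (simp add: squarefree_prime)
    ultimately have "squarefree (p * c) \<longleftrightarrow> squarefree c"
      by (auto intro: squarefree_mult_coprime dest: squarefree_multD)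
    moreover have "prime_factors (p * c) = insert p (prime_factors c)"
      using c \<open>p \<noteq> 0\<close> p by (simp add: prime_factors_product prime_factorization_prime)
    moreover have "p \<notin> prime_factors c" using c by auto
    ultimately show ?thesis by (simp add: moebius_def)
  qed
  have "(\<Sum>c | c dvd p ^ Suc a * m. moebius c * F c) =
      (\<Sum>c\<in>{c. c dvd m} \<union> (*) p ` {c. c dvd m}. moebius c * F c)"
    using fin sub zero by (intro sum.mono_neutral_right) auto
  also have "\<dots> = (\<Sum>c | c dvd m. moebius c * F c) + (\<Sum>c\<in>(*) p ` {c. c dvd m}. moebius c * F c)"
    using p m by (intro sum.union_disjoint) (auto dest: dvd_mult_left)
  also have "(\<Sum>c\<in>(*) p ` {c. c dvd m}. moebius c * F c) = (\<Sum>c | c dvd m. - moebius c * F (p * c))"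
    using \<open>p \<noteq> 0\<close> by (subst sum.reindex) (auto simp: inj_on_def moebius_p intro!: sum.cong)
  also have "(\<Sum>c | c dvd m. moebius c * F c) + (\<Sum>c | c dvd m. - moebius c * F (p * c)) =
      (\<Sum>c | c dvd m. moebius c * (F c - F (p * c)))"
    by (simp add: sum.distrib [symmetric] algebra_simps)
  finally show ?thesis .
qed

lemma jordan_totient_altdef:
  assumes "e > 0"
  shows "jordan_totient k e = (\<Sum>c | c dvd e. moebius c * int (e div c) ^ k)"
  unfolding jordan_totient_def using assms
  by (intro sum.reindex_bij_witness[of _ "(div) e" "(div) e"]) (auto elim!: dvdE)

lemma jordan_totient_1 [simp]: "jordan_totient k (Suc 0) = 1"
  by (simp add: jordan_totient_def moebius_def)

text \<open>
  This is the Euler factor of \<open>J\<^sub>k\<close> at \<open>p\<close>, from which the facts below follow by induction on the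
  prime powers in the argument.
\<close>

lemma jordan_totient_prime_power_times:
  assumes p: "Factorial_Ring.prime p" "\<not> p dvd m" and m: "m > 0"
  shows "jordan_totient k (p ^ Suc a * m) =
    (int p ^ (Suc a * k) - int p ^ (a * k)) * jordan_totient k m"
proof -
  let ?n = "p ^ Suc a * m"
  have "p > 0" using p by (simp add: prime_gt_0_nat)
  then have n: "?n > 0" using m by simp
  have diff: "int (?n div c) ^ k - int (?n div (p * c)) ^ k =
      (int p ^ (Suc a * k) - int p ^ (a * k)) * int (m div c) ^ k" if cm: "c dvd m" for c
  proof -
    obtain d where d: "m = c * d" using cm by blast
    then have c: "c > 0" using m by (cases c) auto
    have "?n div c = p ^ Suc a * d" "?n div (p * c) = p ^ a * d" "m div c = d"
      using c \<open>p > 0\<close> by (simp_all add: d mult_ac)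
    then show ?thesis
      by (simp only: of_nat_mult of_nat_power power_mult_distrib power_mult [symmetric] left_diff_distrib)
  qed
  have "jordan_totient k ?n =
      (\<Sum>c | c dvd m. moebius c * (int (?n div c) ^ k - int (?n div (p * c)) ^ k))"
    unfolding jordan_totient_altdef[OF n] by (rule sum_moebius_prime_power[OF p m])
  also have "\<dots> = (\<Sum>c | c dvd m. (int p ^ (Suc a * k) - int p ^ (a * k)) * (moebius c * int (m div c) ^ k))"
    by (intro sum.cong refl) (simp only: mem_Collect_eq diff, simp only: mult_ac)
  finally show ?thesis
    by (simp add: jordan_totient_altdef[OF m] sum_distrib_left)
qed

lemma divisors_prime_power_Suc_times:
  fixes p m :: nat
  assumes p: "Factorial_Ring.prime p"
  shows "{e. e dvd p ^ Suc a * m} = {e. e dvd p ^ a * m} \<union> (*) (p ^ Suc a) ` {e. e dvd m}"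
proof (intro equalityI subsetI)
  fix e assume "e \<in> {e. e dvd p ^ Suc a * m}"
  then obtain x y where e: "e = x * y" "x dvd p ^ Suc a" "y dvd m"
    using division_decomp[of e "p ^ Suc a" m] by auto
  then obtain i where i: "x = p ^ i" "i \<le> Suc a"
    using divides_primepow_nat[OF p] by blast
  show "e \<in> {e. e dvd p ^ a * m} \<union> (*) (p ^ Suc a) ` {e. e dvd m}"
  proof (cases "i = Suc a")
    case False
    then have "p ^ i dvd p ^ a" using i by (intro le_imp_power_dvd) simp
    then have "e dvd p ^ a * m" using i e by (simp add: mult_dvd_mono)
    then show ?thesis by simp
  qed (use i e in auto)
qed (auto intro: mult_dvd_mono simp: mult.assoc)

text \<open>
  For the powers of one prime the Euler factors form a telescoping sum: a divisor of
  \<open>p ^ Suc b * m\<close> either divides \<open>p ^ b * m\<close> or is \<open>p ^ Suc b\<close> times a divisor of \<open>m\<close>.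
\<close>

lemma sum_jordan_totient_divisors:
  assumes "n > 0"
  shows "(\<Sum>e | e dvd n. jordan_totient k e) = int n ^ k"
  using assms
proof (induction n rule: prime_power_times_coprime_induct)
  case (prime_power p a m)
  have "p > 0" using prime_power(1) by (simp add: prime_gt_0_nat)
  have "(\<Sum>e | e dvd p ^ b * m. jordan_totient k e) = int (p ^ b * m) ^ k" for b
  proof (induction b)
    case 0
    then show ?case using prime_power.IH by simp
  next
    case (Suc b)
    have "(\<Sum>e | e dvd p ^ Suc b * m. jordan_totient k e) =
        (\<Sum>e | e dvd p ^ b * m. jordan_totient k e) +
        (\<Sum>e\<in>(*) (p ^ Suc b) ` {e. e dvd m}. jordan_totient k e)"
      unfolding divisors_prime_power_Suc_times[OF prime_power(1)]
    proof (rule sum.union_disjoint)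
      have "\<not> p ^ Suc b * e dvd p ^ b * m" for e
        using prime_power(2) \<open>p > 0\<close> by (auto simp: mult_ac dest: dvd_mult_left)
      then show "{e. e dvd p ^ b * m} \<inter> (*) (p ^ Suc b) ` {e. e dvd m} = {}" by auto
    qed (use \<open>p > 0\<close> prime_power(3) in auto)
    also have "(\<Sum>e\<in>(*) (p ^ Suc b) ` {e. e dvd m}. jordan_totient k e) =
        (\<Sum>e | e dvd m. (int p ^ (Suc b * k) - int p ^ (b * k)) * jordan_totient k e)"
    proof (subst sum.reindex)
      show "inj_on ((*) (p ^ Suc b)) {e. e dvd m}" using \<open>p > 0\<close> by (simp add: inj_on_def)
      have "jordan_totient k (p ^ Suc b * e) =
          (int p ^ (Suc b * k) - int p ^ (b * k)) * jordan_totient k e" if "e dvd m" for e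
      proof (rule jordan_totient_prime_power_times[OF prime_power(1)])
        show "\<not> p dvd e" using that prime_power(2) dvd_trans by blast
        show "e > 0" using that prime_power(3) by (cases e) auto
      qed
      then show "sum (jordan_totient k \<circ> (*) (p ^ Suc b)) {e. e dvd m} =
          (\<Sum>e | e dvd m. (int p ^ (Suc b * k) - int p ^ (b * k)) * jordan_totient k e)"
        by (intro sum.cong) auto
    qed
    also have "\<dots> = (int p ^ (Suc b * k) - int p ^ (b * k)) * int m ^ k"
      unfolding sum_distrib_left [symmetric] using prime_power.IH by simp
    finally show ?case
      unfolding Suc.IH
      by (simp only: of_nat_mult of_nat_power power_mult_distrib power_mult [symmetric] left_diff_distrib)
  qed
  then show ?case by blast
qed simp

lemma jordan_totient_one_eq_totient:
  assumes "e > 0"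
  shows "jordan_totient 1 e = int (totient e)"
  using assms
proof (induction e rule: prime_power_times_coprime_induct)
  case (prime_power p a m)
  have "coprime (p ^ Suc a) m" using prime_power(1,2) by (metis coprime_power_left_iff prime_imp_coprime)
  then have "int (totient (p ^ Suc a * m)) = int (p ^ a * (p - 1)) * int (totient m)"
    using prime_power(1) by (simp only: totient_mult_coprime totient_prime_power_Suc of_nat_mult)
  moreover have "int (p - 1) = int p - 1" using prime_ge_1_nat[OF prime_power(1)] by linarith
  ultimately show ?case
    using jordan_totient_prime_power_times[OF prime_power(1-3), of 1 a] prime_power.IH
    by (simp add: algebra_simps)
qed simp

lemma jordan_totient_zero:
  assumes "e > 0"
  shows "jordan_totient 0 e = (if e = 1 then 1 else 0)"
  using assms
proof (induction e rule: prime_power_times_coprime_induct)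
  case (prime_power p a m)
  then have "p ^ Suc a * m \<noteq> 1" by auto
  then show ?case using jordan_totient_prime_power_times[OF prime_power(1-3), of 0 a] by simp
qed simp

lemma jordan_totient_nonneg:
  assumes "e > 0"
  shows "jordan_totient k e \<ge> 0"
  using assms
proof (induction e rule: prime_power_times_coprime_induct)
  case (prime_power p a m)
  have "int p ^ (a * k) \<le> int p ^ (Suc a * k)"
    using prime_power(1) by (intro power_increasing) (auto simp: prime_gt_0_nat Suc_le_eq)
  then show ?case
    using prime_power.IH by (simp only: jordan_totient_prime_power_times[OF prime_power(1-3)]) simp
qed simp

text \<open>
  The Euler factor \<open>p ^ (a * k) * (p ^ k - 1)\<close> of \<open>J\<^sub>k\<close> is divisible by the Euler factor
  \<open>p ^ a * (p - 1)\<close> of \<open>\<phi>\<close>.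
\<close>

lemma totient_dvd_jordan_totient:
  assumes "e > 0" "k > 0"
  shows "int (totient e) dvd jordan_totient k e"
  using assms(1)
proof (induction e rule: prime_power_times_coprime_induct)
  case (prime_power p a m)
  have cop: "coprime (p ^ Suc a) m" using prime_power(1,2) by (metis coprime_power_left_iff prime_imp_coprime)
  have "int p ^ (Suc a * k) - int p ^ (a * k) = int p ^ (a * k) * (int p ^ k - 1)"
    by (simp add: power_add algebra_simps)
  moreover have "int p ^ a dvd int p ^ (a * k)"
    using \<open>k > 0\<close> by (intro le_imp_power_dvd) simp
  moreover have "int (p - 1) dvd int p ^ k - 1"
    using prime_ge_1_nat[OF prime_power(1)] power_diff_1_eq[of "int p" k]
    by (simp only: of_nat_diff of_nat_1 dvd_triv_left)
  ultimately have "int (p ^ a * (p - 1)) dvd int p ^ (Suc a * k) - int p ^ (a * k)"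
    by (simp add: mult_dvd_mono)
  then have "int (p ^ a * (p - 1)) * int (totient m) dvd
      (int p ^ (Suc a * k) - int p ^ (a * k)) * jordan_totient k m"
    using prime_power.IH by (rule mult_dvd_mono)
  then show ?case
    using prime_power(1) unfolding jordan_totient_prime_power_times[OF prime_power(1-3)]
    by (simp only: totient_mult_coprime[OF cop] totient_prime_power_Suc of_nat_mult)
qed simp

text \<open>
  Thanks to this divisibility, the zeta function of a sector enters with an integral exponent.
  For \<open>k = 0\<close> the function \<open>J\<^sub>0\<close> vanishes except at 1, where the order is 1.
\<close>

lemma ord_dvd_jordan_totient:
  assumes e: "e > 0" and coprime: "coprime e q"
  shows "int (ord e q) dvd jordan_totient k e"
proof (cases "k = 0")
  case True
  have "ord (Suc 0) q = 1"
    using ord_minimal[of 1 1 q] ord_eq_0[of 1 q] by (cases "ord 1 q \<le> 1") (auto simp: cong_def)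
  then show ?thesis using jordan_totient_zero[OF e] True by auto
next
  case False
  then show ?thesis
    using totient_dvd_jordan_totient[OF e] order_divides_totient[OF coprime] dvd_trans int_dvd_int_iff
    by blast
qed

lemma jordan_totient_div_ord:
  assumes e: "e > 0" "coprime e q"
  shows "int (nat (jordan_totient k e div int (ord e q))) * int (ord e q) = jordan_totient k e"
proof -
  obtain j where j: "jordan_totient k e = int (ord e q) * j"
    using ord_dvd_jordan_totient[OF e] by blast
  have o: "ord e q > 0" using e(2) ord_eq_0[of e q] by simp
  then have "int (ord e q) > 0" by (simp only: of_nat_0_less_iff)
  then have "j \<ge> 0"
    using jordan_totient_nonneg[OF e(1), of k] mult_pos_neg[of "int (ord e q)" j] j by linarith
  then show ?thesis using e(2) by (simp add: j)
qed


section \<open>The order of a finite field\<close>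

text \<open>
  By Sylow's theorem the additive group has a subgroup \<open>H\<close> of order \<open>r\<close>. Translation by an element
  \<open>x\<close> of \<open>H\<close> permutes \<open>H\<close> and adds \<open>r x\<close> to the sum of its elements, so \<open>r x = 0\<close>.
\<close>

lemma prime_dvd_card_field_imp_eq_char:
  assumes r: "Factorial_Ring.prime r" "r dvd CARD('a :: {field, finite})"
  shows "r = CHAR('a)"
proof -
  define G where "G = \<lparr>carrier = (UNIV :: 'a set), monoid.mult = (+), one = (0 :: 'a)\<rparr>"
  have G: "group G"
  proof (rule groupI)
    fix x assume "x \<in> carrier G"
    show "\<exists>y\<in>carrier G. y \<otimes>\<^bsub>G\<^esub> x = \<one>\<^bsub>G\<^esub>"
      by (intro bexI[of _ "-x"]) (auto simp: G_def)
  qed (auto simp: G_def add_ac)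
  obtain m where m: "CARD('a) = r ^ 1 * m" using r(2) by auto
  obtain H where H: "subgroup H G" "card H = r"
    using sylow_thm[OF r(1) G, of 1 m] m by (auto simp: G_def Coset.order_def)
  have fin: "finite H" by simp
  have "\<not> H \<subseteq> {0}"
    using H(2) card_mono[of "{0}" H] prime_gt_1_nat[OF r(1)] by auto
  then obtain x where x: "x \<in> H" "x \<noteq> 0" by blast
  have closed: "h + x \<in> H" if "h \<in> H" for h
    using subgroup.m_closed[OF H(1) that x(1)] by (simp add: G_def)
  have "(+) x ` H = H"
  proof (rule card_subset_eq[OF fin])
    show "(+) x ` H \<subseteq> H" using closed by (auto simp: add.commute)
    show "card ((+) x ` H) = card H" by (simp add: card_image)
  qed
  then have "(\<Sum>h\<in>H. h) = (\<Sum>h\<in>(+) x ` H. h)" by simp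
  also have "\<dots> = (\<Sum>h\<in>H. x + h)" by (simp add: sum.reindex)
  also have "\<dots> = of_nat r * x + (\<Sum>h\<in>H. h)" by (simp add: sum.distrib H(2))
  finally have "of_nat r = (0 :: 'a)" using x(2) by simp
  then have "CHAR('a) dvd r" by (simp add: of_nat_eq_0_iff_char_dvd)
  then show ?thesis
    using r(1) CHAR_not_1' by (metis One_nat_def prime_nat_iff)
qed

text \<open>
  The sector indices are prime to the characteristic. This makes them prime to \<open>q\<close>, so that the
  order of \<open>q\<close> modulo \<open>e\<close> is positive.
\<close>

lemma coprime_card_field:
  assumes "coprime e CHAR('a :: {field, finite})"
  shows "coprime e CARD('a)"
proof (rule ccontr)
  assume "\<not> coprime e CARD('a)"
  then obtain c where c: "c dvd e" "c dvd CARD('a)" "c \<noteq> 1"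
    using not_coprimeE[of e "CARD('a)"] by auto
  then obtain r where "Factorial_Ring.prime r" "r dvd c"
    using prime_factor_nat by blast
  with c have r: "Factorial_Ring.prime r" "r dvd e" "r dvd CARD('a)"
    by (auto intro: dvd_trans)
  then have "coprime e r"
    using assms prime_dvd_card_field_imp_eq_char[OF r(1,3)] by simp
  then have "is_unit r" using r(2) by (rule coprime_common_divisor) simp
  then show False using r(1) not_prime_unit by blast
qed


section \<open>Orbits of the weighted action\<close>

text \<open>
  As \<open>n\<close> is invertible, the derivative \<open>n X ^ (n - 1)\<close> vanishes at most at 0, which is not a root of
  \<open>X ^ n - 1\<close>. So all roots are simple.
\<close>

lemma card_roots_of_unity:
  assumes n: "of_nat n \<noteq> (0 :: 'k :: alg_closed_field)"
  shows "card {c :: 'k. c ^ n = 1} = n"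
proof -
  let ?P = "monom 1 n - 1 :: 'k poly"
  have n0: "n > 0" using n by (cases n) auto
  have deg: "degree ?P = n" and lead: "lead_coeff ?P = 1"
  proof -
    show "degree ?P = n"
      using n0 degree_add_eq_left[of "- 1" "monom 1 n :: 'k poly"] by (simp add: degree_monom_eq)
    then show "lead_coeff ?P = 1" using n0 by simp
  qed
  have "?P \<noteq> 0" using deg n0 by auto
  then obtain A where A: "size A = n" "?P = (\<Prod>x\<in>#A. [:- x, 1:])"
    using alg_closed_imp_factorization[of ?P] deg lead by auto
  have root: "poly ?P c = 0 \<longleftrightarrow> c ^ n = 1" for c
    by (simp add: poly_monom)
  have roots: "{c. c ^ n = 1} = set_mset A"
  proof -
    have "poly ?P c = (\<Prod>x\<in>#A. c - x)" for c
      unfolding A(2) by (induction A) (simp_all add: algebra_simps)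
    then have "poly ?P c = 0 \<longleftrightarrow> c \<in># A" for c
      by (auto simp: prod_mset_zero_iff)
    then show ?thesis using root by blast
  qed
  have "count A x = 1" if x: "x \<in># A" for x
  proof (rule ccontr)
    assume "count A x \<noteq> 1"
    then have "x \<in># A - {#x#}"
      using x by (metis add_mset_remove_trivial_If count_add_mset insert_DiffM not_in_iff
        One_nat_def)
    then obtain B where B: "A = add_mset x (add_mset x B)"
      using x by (metis insert_DiffM)
    define R where "R = (\<Prod>y\<in>#B. [:- y, 1:])"
    have P: "?P = [:- x, 1:] * ([:- x, 1:] * R)"
      unfolding A(2) B R_def by simp
    have "poly (pderiv ?P) x = 0"
      unfolding P by (simp only: pderiv_mult) simp
    then have "of_nat n * x ^ (n - 1) = 0"
      by (simp add: pderiv_diff pderiv_monom poly_monom)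
    then have "x = 0" using n by simp
    moreover have "x ^ n = 1" using x roots by blast
    ultimately show False using n0 by (simp add: power_0_left)
  qed
  then have "size A = card (set_mset A)"
    by (simp add: size_multiset_overloaded_eq)
  then show ?thesis using A(1) roots by simp
qed

lemma power_gcd_eq_1:
  fixes c :: "'k :: field"
  assumes "c ^ a = 1" "c ^ b = 1"
  shows "c ^ gcd a b = 1"
proof (cases "a = 0")
  case False
  then obtain x y where "a * x = b * y + gcd a b" using bezout_nat by blast
  then have "(c ^ a) ^ x = (c ^ b) ^ y * c ^ gcd a b"
    by (simp add: power_mult [symmetric] power_add [symmetric])
  then show ?thesis using assms by simp
qed (use assms in simp)

lemma power_Gcd_eq_1_iff:
  fixes c :: "'k :: field"
  assumes "finite S"
  shows "c ^ Gcd (w ` S) = 1 \<longleftrightarrow> (\<forall>i\<in>S. c ^ w i = 1)"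
proof
  assume c: "c ^ Gcd (w ` S) = 1"
  show "\<forall>i\<in>S. c ^ w i = 1"
  proof
    fix i assume "i \<in> S"
    then have "Gcd (w ` S) dvd w i" by (simp add: Gcd_dvd)
    then obtain j where "w i = Gcd (w ` S) * j" by (rule dvdE)
    then show "c ^ w i = 1" using c by (metis power_mult power_one)
  qed
next
  assume "\<forall>i\<in>S. c ^ w i = 1"
  with assms show "c ^ Gcd (w ` S) = 1"
    by (induction S rule: finite_induct) (auto intro: power_gcd_eq_1)
qed

definition vsupport :: "('i \<Rightarrow> 'k::field) \<Rightarrow> 'i set" where
  "vsupport x = {i. x i \<noteq> 0}"

lemma wscale_1 [simp]: "wscale w 1 x = x"
  by (simp add: wscale_def)

lemma wscale_wscale: "wscale w b (wscale w c x) = wscale w (b * c) x"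
  by (simp add: wscale_def power_mult_distrib mult_ac)

lemma wscale_in_worbit: "c \<noteq> 0 \<Longrightarrow> wscale w c x \<in> worbit w x"
  by (auto simp: worbit_def)

lemma self_in_worbit: "x \<in> worbit w x"
  using wscale_in_worbit[of 1] by simp

lemma worbit_wscale:
  assumes "c \<noteq> 0"
  shows "worbit w (wscale w c x) = worbit w x"
proof -
  have "b \<noteq> 0 \<Longrightarrow> wscale w b x \<in> worbit w (wscale w c x)" for b
    using wscale_in_worbit[of "b / c" w "wscale w c x"] assms by (simp add: wscale_wscale)
  then show ?thesis
    using assms by (auto simp: worbit_def wscale_wscale)
qed

lemma orbit_support_worbit: "orbit_support (worbit w x) = vsupport x"
  using self_in_worbit[of x w] by (auto simp: orbit_support_def vsupport_def worbit_def wscale_def)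

text \<open>
  The stabiliser of \<open>x\<close> under the weighted action is the group of roots of unity of order
  dividing \<open>k\<close>, the greatest common divisor of the weights of its nonzero coordinates.
\<close>

lemma wscale_eq_iff:
  fixes x :: "'i::finite \<Rightarrow> 'k::field"
  assumes "b \<noteq> 0" "c \<noteq> 0"
  shows "wscale w b x = wscale w c x \<longleftrightarrow> (b / c) ^ Gcd (w ` vsupport x) = 1"
  using assms unfolding power_Gcd_eq_1_iff[OF finite]
  by (auto simp: wscale_def vsupport_def fun_eq_iff power_divide)

text \<open>
  Orbit and stabiliser for the group \<open>\<mu>\<^sub>n\<close>: with \<open>k\<close> the greatest common divisor of the weights
  of the nonzero coordinates, the stabiliser is \<open>\<mu>\<^sub>n \<inter> \<mu>\<^sub>k = \<mu>\<^sub>m\<close> for \<open>m = gcd n k\<close>. For \<open>n = Q - 1\<close> the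
  orbits are isomorphism classes of the groupoid over \<open>\<F>\<^sub>Q\<close>; for \<open>n = (Q - 1) k\<close> they are its fibres over
  the coarse space.
\<close>

lemma card_scalings_by_roots_of_unity:
  fixes x :: "'i::finite \<Rightarrow> 'k::alg_closed_field"
  assumes n: "of_nat n \<noteq> (0 :: 'k)"
  shows "card ((\<lambda>c. wscale w c x) ` {c. c ^ n = 1}) * gcd n (Gcd (w ` vsupport x)) = n"
proof -
  let ?k = "Gcd (w ` vsupport x)" and ?\<mu> = "{c :: 'k. c ^ n = 1}" and ?s = "\<lambda>c. wscale w c x"
  have n0: "n > 0" using n by (cases n) auto
  have fin: "finite ?\<mu>"
    using card_roots_of_unity[OF n] n0 by (intro card_ge_0_finite) simp
  obtain j where "n = gcd n ?k * j" using gcd_dvd1 by (rule dvdE)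
  then have "of_nat (gcd n ?k) * of_nat j \<noteq> (0 :: 'k)"
    using n by (metis of_nat_mult)
  then have "of_nat (gcd n ?k) \<noteq> (0 :: 'k)" by auto
  then have card_gcd: "card {c :: 'k. c ^ gcd n ?k = 1} = gcd n ?k"
    by (rule card_roots_of_unity)
  have nz: "c \<noteq> 0" if "c \<in> ?\<mu>" for c using that n0 by (auto simp: power_0_left)
  have fibre: "card {c \<in> ?\<mu>. ?s c = z} = gcd n ?k" if z: "z \<in> ?s ` ?\<mu>" for z
  proof -
    obtain b where b: "b \<in> ?\<mu>" "z = ?s b" using z by blast
    have "bij_betw ((*) b) {c. c ^ gcd n ?k = 1} {c \<in> ?\<mu>. ?s c = z}"
    proof (rule bij_betw_imageI)
      show "inj_on ((*) b) {c. c ^ gcd n ?k = 1}"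
        using nz[OF b(1)] by (simp add: inj_on_def)
      show "(*) b ` {c. c ^ gcd n ?k = 1} = {c \<in> ?\<mu>. ?s c = z}"
      proof (intro equalityI subsetI)
        fix c assume "c \<in> (*) b ` {c. c ^ gcd n ?k = 1}"
        then obtain \<zeta> where \<zeta>: "c = b * \<zeta>" "\<zeta> ^ gcd n ?k = 1" by blast
        have one: "\<zeta> ^ m = 1" if "gcd n ?k dvd m" for m
          using that \<zeta>(2) by (metis dvdE power_mult power_one)
        have "\<zeta> ^ n = 1" "\<zeta> ^ ?k = 1" by (rule one, simp)+
        then show "c \<in> {c \<in> ?\<mu>. ?s c = z}"
          using b \<zeta>(1) nz[OF b(1)] nz[of c] by (simp add: power_mult_distrib wscale_eq_iff)
      next
        fix c assume c: "c \<in> {c \<in> ?\<mu>. ?s c = z}"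
        then have "(c / b) ^ n = 1" using b by (simp add: power_divide)
        moreover have "(c / b) ^ ?k = 1"
          using c b nz[OF b(1)] nz[of c] wscale_eq_iff[of c b w x] by simp
        ultimately have "(c / b) ^ gcd n ?k = 1" by (rule power_gcd_eq_1)
        moreover have "c = b * (c / b)" using nz[OF b(1)] by simp
        ultimately show "c \<in> (*) b ` {c. c ^ gcd n ?k = 1}" by blast
      qed
    qed
    from bij_betw_same_card[OF this] show ?thesis using card_gcd by simp
  qed
  have "n = (\<Sum>c\<in>?\<mu>. 1)" using card_roots_of_unity[OF n] by simp
  also have "\<dots> = (\<Sum>z\<in>?s ` ?\<mu>. \<Sum>c\<in>{c \<in> ?\<mu>. ?s c = z}. 1)"
    by (rule sum.image_gen[OF fin])
  also have "\<dots> = (\<Sum>z\<in>?s ` ?\<mu>. gcd n ?k)"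
    using fibre by (intro sum.cong refl) simp
  finally show ?thesis by simp
qed


section \<open>Rational points of the coarse space and of the stack\<close>

lemma finite_stack_objects:
  fixes C :: "('i::finite \<Rightarrow> 'k::field) set"
  assumes "Q > 1"
  shows "finite (stack_objects C Q)"
proof -
  let ?P = "monom 1 Q - monom 1 1 :: 'k poly"
  have "coeff ?P Q = 1" using assms by simp
  then have "?P \<noteq> 0" by (metis coeff_0 zero_neq_one)
  then have "finite {c. poly ?P c = 0}" by (rule poly_roots_finite)
  moreover have "{c. poly ?P c = 0} = {c. c ^ Q = c}" by (simp add: poly_monom)
  ultimately have "finite (PiE (UNIV :: 'i set) (\<lambda>_. {c :: 'k. c ^ Q = c}))"
    by (intro finite_PiE) simp_all
  then show ?thesis
    by (rule rev_finite_subset) (auto simp: stack_objects_def PiE_def)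
qed

text \<open>
  Hilbert 90 for \<open>\<G>\<^sub>m\<close>: if Frobenius maps \<open>x\<close> to \<open>a \<cdot> x\<close>, choose \<open>b\<close> with \<open>b ^ (Q - 1) = a\<close>. Then
  \<open>b\<^sup>-\<^sup>1 \<cdot> x\<close> is fixed by Frobenius. Hence every Frobenius-stable orbit contains a vector with
  coordinates in \<open>\<F>\<^sub>Q\<close>.
\<close>

lemma rational_points_eq_worbit_stack_objects:
  fixes C :: "('i \<Rightarrow> 'k::alg_closed_field) set"
  assumes Q: "Q > 1" and stable: "\<And>x c. x \<in> C \<Longrightarrow> c \<noteq> 0 \<Longrightarrow> wscale w c x \<in> C"
  shows "rational_points w C Q = worbit w ` stack_objects C Q"
proof (intro equalityI subsetI)
  have frob_wscale: "frob Q (wscale w c x) = wscale w (c ^ Q) (frob Q x)" for c and x :: "'i \<Rightarrow> 'k"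
    by (simp add: frob_def wscale_def power_mult_distrib power_mult [symmetric] mult.commute)
  {
    fix y assume "y \<in> rational_points w C Q"
    then obtain x where x: "x \<in> C" "y = worbit w x" "frob Q ` y = y"
      by (auto simp: rational_points_def coarse_points_def)
    have "frob Q x \<in> worbit w x" using x self_in_worbit by blast
    then obtain a where a: "a \<noteq> 0" "frob Q x = wscale w a x"
      by (auto simp: worbit_def)
    obtain b where b: "b ^ (Q - 1) = a"
      using nth_root_exists[of "Q - 1" a] Q by auto
    have b0: "b \<noteq> 0" using b a(1) Q by (auto simp: power_0_left)
    have bQ: "b ^ Q = b * a"
      using b Q by (metis Suc_diff_1 less_trans power_Suc zero_less_one)
    let ?z = "wscale w (1 / b) x"
    have "frob Q ?z = wscale w ((1 / b) ^ Q * a) x"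
      by (simp add: frob_wscale a(2) wscale_wscale)
    also have "(1 / b) ^ Q * a = 1 / b"
      using b0 a(1) by (simp add: power_divide bQ)
    finally have "?z \<in> stack_objects C Q"
      using stable[OF x(1), of "1 / b"] b0 by (auto simp: stack_objects_def frob_def fun_eq_iff)
    moreover have "worbit w ?z = y" using b0 x(2) by (simp add: worbit_wscale)
    ultimately show "y \<in> worbit w ` stack_objects C Q" by blast
  next
    fix y assume "y \<in> worbit w ` stack_objects C Q"
    then obtain x where x: "x \<in> C" "frob Q x = x" "y = worbit w x"
      by (auto simp: stack_objects_def frob_def)
    have "wscale w c x \<in> frob Q ` worbit w x" if c: "c \<noteq> 0" for c
    proof -
      obtain b where b: "b ^ Q = c" using nth_root_exists[of Q c] Q by auto
      then have "b \<noteq> 0" using c Q by (auto simp: power_0_left)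
      moreover have "frob Q (wscale w b x) = wscale w c x" by (simp add: frob_wscale x(2) b)
      ultimately show ?thesis by (metis wscale_in_worbit image_eqI)
    qed
    moreover have "frob Q (wscale w c x) \<in> worbit w x" if "c \<noteq> 0" for c
      using that wscale_in_worbit[of "c ^ Q" w x] by (simp add: frob_wscale x(2))
    ultimately have "frob Q ` worbit w x = worbit w x"
      by (auto simp: worbit_def)
    then show "y \<in> rational_points w C Q"
      using x by (auto simp: rational_points_def coarse_points_def)
  }
qed

lemma equiv_stack_iso:
  assumes "Q > 0"
  shows "equiv (stack_objects C Q) (stack_iso w C Q)"
proof (rule equivI)
  show "stack_iso w C Q \<subseteq> stack_objects C Q \<times> stack_objects C Q"
    by (auto simp: stack_iso_def)
  show "refl_on (stack_objects C Q) (stack_iso w C Q)"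
    by (auto simp: refl_on_def stack_iso_def intro!: exI[of _ 1])
  show "sym (stack_iso w C Q)"
  proof (rule symI)
    fix x y assume "(x, y) \<in> stack_iso w C Q"
    then obtain c where c: "c \<noteq> 0" "c ^ Q = c" "y = wscale w c x"
      and xy: "x \<in> stack_objects C Q" "y \<in> stack_objects C Q"
      by (auto simp: stack_iso_def)
    have "x = wscale w (1 / c) y" using c by (simp add: wscale_wscale)
    then show "(y, x) \<in> stack_iso w C Q"
      using c xy by (auto simp: stack_iso_def power_divide intro!: exI[of _ "1 / c"])
  qed
  show "trans (stack_iso w C Q)"
  proof (rule transI)
    fix x y z assume "(x, y) \<in> stack_iso w C Q" "(y, z) \<in> stack_iso w C Q"
    then obtain b c where "c \<noteq> 0" "c ^ Q = c" "y = wscale w c x" "b \<noteq> 0" "b ^ Q = b" "z = wscale w b y"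
      "x \<in> stack_objects C Q" "z \<in> stack_objects C Q"
      by (auto simp: stack_iso_def)
    then show "(x, z) \<in> stack_iso w C Q"
      by (auto simp: stack_iso_def wscale_wscale power_mult_distrib intro!: exI[of _ "b * c"])
  qed
qed

text \<open>
  Let \<open>g\<close> be the order of the stabiliser in \<open>\<F>\<^sub>Q\<^sup>\<times>\<close>, a function constant on orbits. An isomorphism
  class has \<open>(Q - 1) / g\<close> elements, while every rational orbit contains exactly \<open>Q - 1\<close> vectors
  over \<open>\<F>\<^sub>Q\<close>. Both sides, multiplied by \<open>Q - 1\<close>, are therefore the sum of \<open>g\<close> over all vectors
  over \<open>\<F>\<^sub>Q\<close>, grouped by classes or by orbits. Tameness ensures that \<open>\<mu>\<^sub>k\<close> has \<open>k\<close> elements.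
\<close>

lemma card_stack_pi0:
  fixes C :: "('i::finite \<Rightarrow> 'k::alg_closed_field) set"
  assumes Q: "Q > 1" "of_nat Q = (0 :: 'k)"
    and stable: "\<And>x c. x \<in> C \<Longrightarrow> c \<noteq> 0 \<Longrightarrow> wscale w c x \<in> C"
    and nonzero: "\<And>x. x \<in> C \<Longrightarrow> x \<noteq> (\<lambda>_. 0)"
    and tame: "\<And>i. of_nat (w i) \<noteq> (0 :: 'k)"
  shows "card (stack_pi0 w C Q) = (\<Sum>y\<in>rational_points w C Q. stab_gcd w y Q)"
proof -
  let ?O = "stack_objects C Q" and ?k = "\<lambda>x :: 'i \<Rightarrow> 'k. Gcd (w ` vsupport x)"
  have fin: "finite ?O" using Q by (rule_tac finite_stack_objects)
  have Q1: "of_nat (Q - 1) \<noteq> (0 :: 'k)"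
    using Q by (simp add: of_nat_diff)
  have pow_Q: "c ^ Q = c \<longleftrightarrow> c ^ (Q - 1) = 1" if "c \<noteq> 0" for c :: 'k
    using that Q by (cases Q) auto
  have k: "of_nat (?k x) \<noteq> (0 :: 'k)" if xC: "x \<in> C" for x
  proof -
    obtain i where "i \<in> vsupport x" using nonzero[OF xC] by (auto simp: vsupport_def)
    then have "?k x dvd w i" by (simp add: Gcd_dvd)
    then obtain j where "w i = ?k x * j" by blast
    then show ?thesis using tame[of i] by auto
  qed
  have root_nz: "c \<noteq> 0" if "c ^ n = 1" "of_nat n \<noteq> (0 :: 'k)" for n and c :: 'k
    using that by (cases n) auto
  \<comment> \<open>Frobenius scales \<open>c \<cdot> x\<close> by \<open>c ^ (Q - 1)\<close>, so \<open>c \<cdot> x\<close> is fixed iff this lies in the stabiliser \<open>\<mu>\<^sub>k\<close>.\<close>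
  have orbit_card: "card {z \<in> ?O. worbit w z = worbit w x} = Q - 1" if x: "x \<in> ?O" for x
  proof -
    have xC: "x \<in> C" and xQ: "\<And>i. x i ^ Q = x i" using x by (auto simp: stack_objects_def)
    have n: "of_nat ((Q - 1) * ?k x) \<noteq> (0 :: 'k)" using Q1 k[OF xC] by simp
    have scale: "wscale w c x \<in> ?O \<longleftrightarrow> c ^ ((Q - 1) * ?k x) = 1" if c: "c \<noteq> 0" for c
    proof -
      have "wscale w c x \<in> ?O \<longleftrightarrow> (\<forall>i. (c ^ w i * x i) ^ Q = c ^ w i * x i)"
        using stable[OF xC c] by (simp add: stack_objects_def wscale_def)
      also have "\<dots> \<longleftrightarrow> (\<forall>i\<in>vsupport x. (c ^ w i) ^ Q = c ^ w i)"
        using xQ by (auto simp: power_mult_distrib vsupport_def)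
      also have "\<dots> \<longleftrightarrow> (\<forall>i\<in>vsupport x. (c ^ (Q - 1)) ^ w i = 1)"
      proof -
        have "(c ^ w i) ^ Q = c ^ w i \<longleftrightarrow> (c ^ (Q - 1)) ^ w i = 1" for i
          using pow_Q[of "c ^ w i"] c
          by (simp only: power_not_zero not_False_eq_True simp_thms) (metis power_mult mult.commute)
        then show ?thesis by blast
      qed
      also have "\<dots> \<longleftrightarrow> (c ^ (Q - 1)) ^ ?k x = 1"
        by (rule power_Gcd_eq_1_iff [symmetric]) simp
      finally show ?thesis by (simp add: power_mult)
    qed
    have "{z \<in> ?O. worbit w z = worbit w x} = (\<lambda>c. wscale w c x) ` {c. c ^ ((Q - 1) * ?k x) = 1}"
    proof (intro equalityI subsetI)
      fix z assume z: "z \<in> {z \<in> ?O. worbit w z = worbit w x}"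
      then have "z \<in> worbit w x" using self_in_worbit by blast
      then obtain c where "c \<noteq> 0" "z = wscale w c x" by (auto simp: worbit_def)
      then show "z \<in> (\<lambda>c. wscale w c x) ` {c. c ^ ((Q - 1) * ?k x) = 1}"
        using z scale by blast
    next
      fix z assume "z \<in> (\<lambda>c. wscale w c x) ` {c. c ^ ((Q - 1) * ?k x) = 1}"
      then obtain c where c: "c ^ ((Q - 1) * ?k x) = 1" "z = wscale w c x" by blast
      then show "z \<in> {z \<in> ?O. worbit w z = worbit w x}"
        using scale root_nz[OF c(1) n] by (simp add: worbit_wscale)
    qed
    then have "card {z \<in> ?O. worbit w z = worbit w x} * ?k x = (Q - 1) * ?k x"
      using card_scalings_by_roots_of_unity[OF n, of w x] by simp
    moreover have "?k x \<noteq> 0" using k[OF xC] by (metis of_nat_0)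
    ultimately show ?thesis by simp
  qed
  \<comment> \<open>The nonzero elements of \<open>\<F>\<^sub>Q\<close> are the roots of unity of order dividing \<open>Q - 1\<close>.\<close>
  have class_card: "card (stack_iso w C Q `` {x}) * gcd (Q - 1) (?k x) = Q - 1" if x: "x \<in> ?O" for x
  proof -
    have "stack_iso w C Q `` {x} = (\<lambda>c. wscale w c x) ` {c. c ^ (Q - 1) = 1}"
    proof (intro equalityI subsetI)
      fix z assume "z \<in> stack_iso w C Q `` {x}"
      then show "z \<in> (\<lambda>c. wscale w c x) ` {c. c ^ (Q - 1) = 1}"
        using pow_Q by (auto simp: stack_iso_def)
    next
      fix z assume "z \<in> (\<lambda>c. wscale w c x) ` {c. c ^ (Q - 1) = 1}"
      then obtain c where c: "c ^ (Q - 1) = 1" "z = wscale w c x" by blast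
      have c0: "c \<noteq> 0" by (rule root_nz[OF c(1) Q1])
      then have cQ: "c ^ Q = c" using c(1) pow_Q by blast
      have "(c ^ w i) ^ Q = c ^ w i" for i
        using cQ by (metis power_mult mult.commute)
      then have "z \<in> ?O"
        using x c0 stable by (auto simp: stack_objects_def c(2) power_mult_distrib)
           (auto simp: wscale_def power_mult_distrib)
      then show "z \<in> stack_iso w C Q `` {x}"
        using x c c0 cQ by (auto simp: stack_iso_def)
    qed
    then show ?thesis using card_scalings_by_roots_of_unity[OF Q1, of w x] by simp
  qed
  have iso_k: "?k z = ?k x" if "z \<in> stack_iso w C Q `` {x}" for x z
    using that by (auto simp: stack_iso_def wscale_def vsupport_def)
  \<comment> \<open>Now the sum of \<open>g\<close> over all vectors is taken in the two ways.\<close>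
  let ?g = "\<lambda>x. gcd (Q - 1) (?k x)"
  have "(Q - 1) * card (stack_pi0 w C Q) = (\<Sum>K\<in>stack_pi0 w C Q. \<Sum>x\<in>K. ?g x)"
  proof -
    have "(\<Sum>x\<in>K. ?g x) = Q - 1" if K: "K \<in> stack_pi0 w C Q" for K
    proof -
      obtain x where x: "x \<in> ?O" "K = stack_iso w C Q `` {x}"
        using K by (auto simp: stack_pi0_def quotient_def)
      have "(\<Sum>z\<in>K. ?g z) = (\<Sum>z\<in>K. ?g x)"
        using iso_k x(2) by (intro sum.cong) auto
      then show ?thesis using class_card[OF x(1)] x(2) by simp
    qed
    then show ?thesis by simp
  qed
  also have "\<dots> = (\<Sum>x\<in>?O. ?g x)"
  proof -
    have eq: "equiv ?O (stack_iso w C Q)" using Q by (intro equiv_stack_iso) simp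
    have "(\<Sum>x\<in>\<Union> (stack_pi0 w C Q). ?g x) = (\<Sum>K\<in>stack_pi0 w C Q. \<Sum>x\<in>K. ?g x)"
      unfolding stack_pi0_def
      using fin finite_equiv_class[OF fin equiv_type[OF eq]] quotient_disj[OF eq]
      by (intro sum.Union_disjoint[simplified]) blast+
    moreover have "\<Union> (stack_pi0 w C Q) = ?O"
      unfolding stack_pi0_def by (rule Union_quotient[OF eq])
    ultimately show ?thesis by simp
  qed
  also have "\<dots> = (\<Sum>y\<in>worbit w ` ?O. \<Sum>x\<in>{x \<in> ?O. worbit w x = y}. ?g x)"
    by (rule sum.image_gen[OF fin])
  also have "\<dots> = (\<Sum>y\<in>worbit w ` ?O. (Q - 1) * stab_gcd w y Q)"
  proof (intro sum.cong refl)
    fix y assume "y \<in> worbit w ` ?O"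
    then obtain x where x: "x \<in> ?O" "y = worbit w x" by blast
    have "?g z = stab_gcd w y Q" if "worbit w z = y" for z
      using that orbit_support_worbit[of w z] by (simp add: stab_gcd_def gcd.commute)
    then have "(\<Sum>z\<in>{z \<in> ?O. worbit w z = y}. ?g z) =
        (\<Sum>z\<in>{z \<in> ?O. worbit w z = y}. stab_gcd w y Q)"
      by (intro sum.cong) auto
    then show "(\<Sum>z\<in>{z \<in> ?O. worbit w z = y}. ?g z) = (Q - 1) * stab_gcd w y Q"
      using orbit_card[OF x(1)] x(2) by simp
  qed
  also have "worbit w ` ?O = rational_points w C Q"
    using rational_points_eq_worbit_stack_objects[OF Q(1) stable] by simp
  finally show ?thesis
    using Q by (simp add: sum_distrib_left [symmetric])
qed


section \<open>Sectors\<close>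

lemma mp_eval_wscale:
  assumes "whomog w d h"
  shows "mp_eval h (wscale w c x) = c ^ d * mp_eval h x"
proof -
  have "(\<Prod>v\<in>Poly_Mapping.keys m. wscale w c x v ^ Poly_Mapping.lookup m v) =
      c ^ d * (\<Prod>v\<in>Poly_Mapping.keys m. x v ^ Poly_Mapping.lookup m v)"
    if "m \<in> Poly_Mapping.keys h" for m
  proof -
    have "d = (\<Sum>v\<in>Poly_Mapping.keys m. w v * Poly_Mapping.lookup m v)"
      using assms that by (simp add: whomog_def)
    then show ?thesis
      by (simp add: wscale_def power_mult_distrib prod.distrib power_mult [symmetric] power_sum)
  qed
  then show ?thesis
    by (simp add: mp_eval_def sum_distrib_left mult_ac)
qed

lemma whomog_map:
  assumes "whomog w d h" "g 0 = 0"
  shows "whomog w d (Poly_Mapping.map g h)"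
proof -
  have "Poly_Mapping.keys (Poly_Mapping.map g h) \<subseteq> Poly_Mapping.keys h"
    by (auto simp: in_keys_iff Poly_Mapping.map.rep_eq when_def split: if_splits)
  then show ?thesis using assms(1) by (auto simp: whomog_def)
qed

lemma hypersurface_cone_wscale:
  assumes f: "whomog w d f" and x: "x \<in> hypersurface_cone f" and c: "c \<noteq> 0"
  shows "wscale w c x \<in> hypersurface_cone f"
proof -
  have "wscale w c x \<noteq> (\<lambda>_. 0)" if "x \<noteq> (\<lambda>_. 0)"
    using that c by (auto simp: wscale_def fun_eq_iff)
  then show ?thesis
    using x mp_eval_wscale[OF whomog_map[OF f, of to_ac], of c x]
    by (simp add: hypersurface_cone_def)
qed

lemma finite_sector_indices:
  fixes w :: "'i::finite \<Rightarrow> nat"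
  assumes "\<And>i. w i > 0"
  shows "finite (sector_indices p w)"
proof (rule finite_subset)
  show "sector_indices p w \<subseteq> (\<Union>i. {e. e dvd w i})"
    by (auto simp: sector_indices_def)
qed (use assms in auto)

lemma rational_points_sector:
  "rational_points w {x \<in> C. \<forall>i. \<not> e dvd w i \<longrightarrow> x i = 0} Q =
    {y \<in> rational_points w C Q. \<forall>i\<in>orbit_support y. e dvd w i}"
  by (auto simp: rational_points_def coarse_points_def orbit_support_worbit vsupport_def intro!: imageI)

text \<open>
  A point with stabiliser order \<open>g\<close> contributes \<open>g ^ k\<close>, which is the sum of \<open>J\<^sub>k e\<close> over the
  divisors \<open>e\<close> of \<open>g\<close>. Exchanging the sums attaches to each \<open>J\<^sub>k e\<close> the points of the sector of \<open>e\<close>.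
  By tameness these \<open>e\<close> are prime to \<open>p\<close>, so that they occur among the sector indices.
\<close>

lemma Theta_eq_sum_sectors:
  fixes w :: "'i::finite \<Rightarrow> nat"
  assumes fin: "finite (rational_points w C (q ^ r))"
    and nonzero: "\<And>x. x \<in> C \<Longrightarrow> x \<noteq> (\<lambda>_. 0)"
    and w_pos: "\<And>i. w i > 0" and p: "Factorial_Ring.prime p" and w_tame: "\<And>i. \<not> p dvd w i"
    and s: "s \<le> 1"
  shows "Theta w C q s r = (\<Sum>e\<in>sector_indices p w. if e dvd q ^ r - 1
    then of_int (jordan_totient (nat (1 - s)) e) *
      real (card (rational_points w {x \<in> C. \<forall>i. \<not> e dvd w i \<longrightarrow> x i = 0} (q ^ r)))
    else 0)"
proof -
  let ?Q = "q ^ r" and ?E = "sector_indices p w" and ?J = "\<lambda>e. jordan_totient (nat (1 - s)) e"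
  let ?R = "rational_points w C ?Q"
  let ?P = "\<lambda>y e. e dvd ?Q - 1 \<and> (\<forall>i\<in>orbit_support y. e dvd w i)"
  have finE: "finite ?E" using w_pos by (rule finite_sector_indices)
  have point: "real (stab_gcd w y ?Q) powi (1 - s) = (\<Sum>e\<in>?E. if ?P y e then of_int (?J e) else 0)"
    if y: "y \<in> ?R" for y
  proof -
    obtain x where x: "x \<in> C" "y = worbit w x"
      using y by (auto simp: rational_points_def coarse_points_def)
    obtain i where i: "i \<in> orbit_support y"
      using nonzero[OF x(1)] by (auto simp: x(2) orbit_support_worbit vsupport_def)
    have dvd_iff: "e dvd stab_gcd w y ?Q \<longleftrightarrow> ?P y e" for e
      by (auto simp: stab_gcd_def dvd_Gcd_iff)
    have g0: "stab_gcd w y ?Q > 0"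
      using w_pos[of i] i by (auto simp: stab_gcd_def intro!: Nat.gr0I)
    have "{e. e dvd stab_gcd w y ?Q} = {e \<in> ?E. ?P y e}"
    proof -
      have "e \<in> ?E" if e: "?P y e" for e
      proof -
        have "e dvd w i" using e i by blast
        moreover from this have "e \<ge> 1" using w_pos[of i] by (cases e) auto
        moreover have "\<not> p dvd e" using \<open>e dvd w i\<close> w_tame[of i] dvd_trans by blast
        then have "coprime e p" using p prime_imp_coprime coprime_commute by blast
        ultimately show ?thesis by (auto simp: sector_indices_def)
      qed
      then show ?thesis using dvd_iff by blast
    qed
    then have "(\<Sum>e | e \<in> ?E \<and> ?P y e. ?J e) = int (stab_gcd w y ?Q) ^ nat (1 - s)"
      using sum_jordan_totient_divisors[OF g0] by simp
    from arg_cong[OF this, of real_of_int]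
    have "real (stab_gcd w y ?Q) ^ nat (1 - s) = (\<Sum>e | e \<in> ?E \<and> ?P y e. of_int (?J e))"
      by (simp only: of_int_sum of_int_power of_int_of_nat_eq)
    also have "\<dots> = (\<Sum>e\<in>?E. if ?P y e then of_int (?J e) else 0)"
      by (rule sum.inter_filter[OF finE])
    finally show ?thesis using s by (simp add: power_int_def)
  qed
  have "Theta w C q s r = (\<Sum>y\<in>?R. \<Sum>e\<in>?E. if ?P y e then of_int (?J e) else 0)"
    unfolding Theta_def by (intro sum.cong refl point)
  also have "\<dots> = (\<Sum>e\<in>?E. \<Sum>y\<in>?R. if ?P y e then of_int (?J e) else 0)"
    by (rule sum.swap)
  also have "\<dots> = (\<Sum>e\<in>?E. if e dvd ?Q - 1 then of_int (?J e) *
      real (card {y \<in> ?R. \<forall>i\<in>orbit_support y. e dvd w i}) else 0)"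
    using fin by (intro sum.cong refl) (simp add: sum.inter_filter [symmetric])
  finally show ?thesis by (simp only: rational_points_sector)
qed

lemma dvd_power_minus_1_iff_ord_dvd:
  fixes q :: nat
  assumes "q > 0"
  shows "e dvd q ^ r - 1 \<longleftrightarrow> ord e q dvd r"
proof -
  have "q ^ r > 0" using assms by simp
  then have "1 \<le> q ^ r" by linarith
  then have "[q ^ r = 1] (mod e) \<longleftrightarrow> e dvd q ^ r - 1" by (rule cong_altdef_nat)
  then show ?thesis using ord_divides by blast
qed

text \<open>
  Over the empty variety the empty list of charts is a covering that refines every other one,
  and all cochains on it are coboundaries. So every linear combination is a relation, and no
  nonempty family is independent, as \<open>1 \<noteq> 0\<close> in \<open>\<int>\<^sub>l\<close>.
\<close>

lemma euler_char_empty: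
  assumes l: "Factorial_Ring.prime l"
  shows "euler_char w l {} = 0"
proof -
  have cover: "etale_cover w {} []" by (simp add: etale_cover_def)
  have rel: "etale_relation w {} N i as ms" for N i as and ms :: "('a, 'b) cech_rep list"
    unfolding etale_relation_def
    by (rule exI[of _ "[]"]) (simp add: cover cover_refinement_def cech_coboundary_def cech_cochain_def)
  have "ms = []" if ind: "ladic_independent w {} l i ms"
    for i and ms :: "(nat \<Rightarrow> ('a, 'b) cech_rep) list"
  proof (rule ccontr)
    assume "ms \<noteq> []"
    let ?as = "replicate (length ms) (\<lambda>_ :: nat. 1 :: int)"
    have "\<forall>a\<in>set ?as. ladic_zero l a"
      using ind rel unfolding ladic_independent_def
      by (elim allE[of _ ?as]) (simp add: ladic_int_def)
    then have "ladic_zero l (\<lambda>_. 1)" using \<open>ms \<noteq> []\<close> by simp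
    then have "[1 = 0] (mod int l ^ 1)" unfolding ladic_zero_def by blast
    then show False using l by (simp add: cong_0_iff)
  qed
  moreover have "ladic_independent w {} l i []" for i
    by (simp add: ladic_independent_def)
  ultimately have "{length ms |ms. (\<forall>m\<in>set ms. ladic_class w {} l i m) \<and>
      ladic_independent w ({} :: ('a \<Rightarrow> 'b) set) l i ms} = {0}" for i
    by force
  then have "ladic_betti w ({} :: ('a \<Rightarrow> 'b) set) l i = 0" for i
    by (simp add: ladic_betti_def)
  then show ?thesis by (simp add: euler_char_def)
qed

lemma hasse_weil_zeta_empty: "hasse_weil_zeta w {} Q = 1"
  by (simp add: hasse_weil_zeta_def rational_points_def coarse_points_def zeta_series_0)

text \<open>
  The factor \<open>o\<close> in \<open>J\<^sub>k(e) = n o\<close>, with \<open>o\<close> the order of \<open>q\<close> modulo \<open>e\<close>, is used up by the dilation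
  in \<open>zeta_series_dilate\<close>; the remaining \<open>n\<close> becomes the exponent.
\<close>

lemma Zcan_eq_prod_sectors:
  fixes w :: "'i::finite \<Rightarrow> nat" and C :: "('i \<Rightarrow> 'k::alg_closed_field) set"
  assumes q: "q > 1" and coprime: "\<And>e. e \<in> sector_indices p w \<Longrightarrow> coprime e q"
    and stable: "\<And>x c. x \<in> C \<Longrightarrow> c \<noteq> 0 \<Longrightarrow> wscale w c x \<in> C"
    and nonzero: "\<And>x. x \<in> C \<Longrightarrow> x \<noteq> (\<lambda>_. 0)"
    and w_pos: "\<And>i. w i > 0" and p: "Factorial_Ring.prime p" and w_tame: "\<And>i. \<not> p dvd w i"
    and s: "s \<le> 1"
  shows "Zcan w C q s = (\<Prod>e\<in>sector_indices p w.
    (hasse_weil_zeta w {x \<in> C. \<forall>i. \<not> e dvd w i \<longrightarrow> x i = 0} (q ^ ord e q) oo fps_X ^ ord e q) ^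
      nat (jordan_totient (nat (1 - s)) e div int (ord e q)))"
proof -
  let ?E = "sector_indices p w"
  let ?n = "\<lambda>e. nat (jordan_totient (nat (1 - s)) e div int (ord e q))"
  let ?b = "\<lambda>e m. real (card (rational_points w {x \<in> C. \<forall>i. \<not> e dvd w i \<longrightarrow> x i = 0}
    ((q ^ ord e q) ^ m)))"
  have e: "e > 0" "ord e q > 0" if "e \<in> ?E" for e
    using coprime[OF that] ord_eq_0[of e q] that by (auto simp: sector_indices_def)
  have J: "of_int (jordan_totient (nat (1 - s)) e) = real (?n e) * real (ord e q)" if "e \<in> ?E" for e
    using jordan_totient_div_ord[OF e(1)[OF that] coprime[OF that], of "nat (1 - s)"]
    by (metis of_int_mult of_int_of_nat_eq)
  have "Theta w C q s r =
      (\<Sum>e\<in>?E. real (?n e) * (if ord e q dvd r then real (ord e q) * ?b e (r div ord e q) else 0))"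
    if r: "r > 0" for r
  proof -
    have "q ^ r > 1" using q r by (rule one_less_power)
    then have "finite (rational_points w C (q ^ r))"
      using rational_points_eq_worbit_stack_objects[OF _ stable, of "q ^ r"] finite_stack_objects
      by (metis finite_imageI)
    then have "Theta w C q s r = (\<Sum>e\<in>?E. if e dvd q ^ r - 1
        then of_int (jordan_totient (nat (1 - s)) e) *
          real (card (rational_points w {x \<in> C. \<forall>i. \<not> e dvd w i \<longrightarrow> x i = 0} (q ^ r))) else 0)"
      using nonzero w_pos p w_tame s by (rule Theta_eq_sum_sectors)
    also have "(\<Sum>e\<in>?E. if e dvd q ^ r - 1 then of_int (jordan_totient (nat (1 - s)) e) *
          real (card (rational_points w {x \<in> C. \<forall>i. \<not> e dvd w i \<longrightarrow> x i = 0} (q ^ r))) else 0) =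
        (\<Sum>e\<in>?E. real (?n e) * (if ord e q dvd r then real (ord e q) * ?b e (r div ord e q) else 0))"
    proof (intro sum.cong refl)
      fix e assume "e \<in> ?E"
      then show "(if e dvd q ^ r - 1 then of_int (jordan_totient (nat (1 - s)) e) *
            real (card (rational_points w {x \<in> C. \<forall>i. \<not> e dvd w i \<longrightarrow> x i = 0} (q ^ r))) else 0) =
          real (?n e) * (if ord e q dvd r then real (ord e q) * ?b e (r div ord e q) else 0)"
        using dvd_power_minus_1_iff_ord_dvd[of q e r] q J[of e]
        by (simp add: power_mult [symmetric])
    qed
    finally show ?thesis .
  qed
  then have "Zcan w C q s = zeta_series (\<lambda>r. \<Sum>e\<in>?E. real (?n e) *
      (if ord e q dvd r then real (ord e q) * ?b e (r div ord e q) else 0))"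
    unfolding Zcan_def by (intro zeta_series_cong) blast
  also have "\<dots> = (\<Prod>e\<in>?E. zeta_series (\<lambda>r. real (?n e) *
      (if ord e q dvd r then real (ord e q) * ?b e (r div ord e q) else 0)))"
    by (rule zeta_series_sum[OF finite_sector_indices[OF w_pos]])
  also have "\<dots> = (\<Prod>e\<in>?E. (zeta_series (?b e) oo fps_X ^ ord e q) ^ ?n e)"
  proof (intro prod.cong refl)
    fix e assume "e \<in> ?E"
    then have "ord e q > 0" by (rule e(2))
    from zeta_series_dilate[OF this, of "?b e"]
    show "zeta_series (\<lambda>r. real (?n e) *
        (if ord e q dvd r then real (ord e q) * ?b e (r div ord e q) else 0)) =
      (zeta_series (?b e) oo fps_X ^ ord e q) ^ ?n e"
      unfolding zeta_series_scale by simp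
  qed
  finally show ?thesis by (simp only: hasse_weil_zeta_def)
qed

lemma Ztw_eq_Zcan:
  fixes w :: "'i::finite \<Rightarrow> nat" and C :: "('i \<Rightarrow> 'k::alg_closed_field) set"
  assumes q: "q > 1" "of_nat q = (0 :: 'k)"
    and "\<And>x c. x \<in> C \<Longrightarrow> c \<noteq> 0 \<Longrightarrow> wscale w c x \<in> C"
    and "\<And>x. x \<in> C \<Longrightarrow> x \<noteq> (\<lambda>_. 0)"
    and "\<And>i. of_nat (w i) \<noteq> (0 :: 'k)"
  shows "Ztw w C q = Zcan w C q 0"
  unfolding Ztw_def Zcan_def
proof (rule zeta_series_cong)
  fix r :: nat assume r: "r > 0"
  have "q ^ r > 1" "of_nat (q ^ r) = (0 :: 'k)" using one_less_power[OF q(1) r] q r by simp_all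
  then have "card (stack_pi0 w C (q ^ r)) = (\<Sum>y\<in>rational_points w C (q ^ r). stab_gcd w y (q ^ r))"
    using assms(3-5) by (rule card_stack_pi0)
  then show "real (card (stack_pi0 w C (q ^ r))) = Theta w C q 0 r"
    by (simp add: Theta_def)
qed


section \<open>The functional equation\<close>

theorem theorem9p6:
  fixes w :: "'i::finite \<Rightarrow> nat"
    and f :: "('i, 'a::{field, finite}) mpoly"
    and q p l d \<delta> :: nat
  assumes q: "q = CARD('a)"
    and p: "p = CHAR('a)"
    and l: "Factorial_Ring.prime l" "l \<noteq> p"
    and w_pos: "\<And>i. w i > 0"
    and w_tame: "\<And>i. \<not> p dvd w i"
    and f: "f \<noteq> 0" "whomog w d f"
    and dim_X: "wdim w (hypersurface_cone f) = ereal (real \<delta>)"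
    and sectors_self_dual: "\<And>e. e \<in> sector_indices p w \<Longrightarrow> sector_cone w f e \<noteq> {} \<Longrightarrow>
           self_dual l w (sector_cone w f e) (q ^ ord e q)"
    and sectors_dim: "\<And>e. e \<in> sector_indices p w \<Longrightarrow> sector_cone w f e \<noteq> {} \<Longrightarrow>
           wdim w (sector_cone w f e) = ereal (real \<delta>)"
  shows "(\<forall>s::int. s \<le> 1 \<longrightarrow>
           functional_equation (Zcan w (hypersurface_cone f) q s) q \<delta>
             (\<Sum>e\<in>sector_indices p w.
                jordan_totient (nat (1 - s)) e * euler_char w l (sector_cone w f e))) \<and>
         functional_equation (Ztw w (hypersurface_cone f) q) q \<delta>
           (\<Sum>e\<in>sector_indices p w. int (totient e) * euler_char w l (sector_cone w f e))"
proof -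
  let ?E = "sector_indices p w" and ?C = "hypersurface_cone f"
  have "card {0, 1 :: 'a} \<le> CARD('a)" by (intro card_mono) auto
  then have q1: "q > 1" by (simp add: q)
  have prime_p: "Factorial_Ring.prime p"
    unfolding p by (intro prime_CHAR_semidom finite_imp_CHAR_pos) simp
  have "of_nat q = (0 :: 'a)"
    using CHAR_dvd_CARD by (simp add: q of_nat_eq_0_iff_char_dvd)
  then have q0: "of_nat q = (0 :: 'a alg_closure)"
    by (simp add: of_nat_eq_0_iff_char_dvd)
  have w_nz: "of_nat (w i) \<noteq> (0 :: 'a alg_closure)" for i
    using w_tame[of i] by (simp add: of_nat_eq_0_iff_char_dvd p)
  have coprime: "coprime e q" if "e \<in> ?E" for e
    using that coprime_card_field by (auto simp: sector_indices_def q p)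
  have nonzero: "x \<noteq> (\<lambda>_. 0)" if "x \<in> ?C" for x
    using that by (simp add: hypersurface_cone_def)
  have stable: "wscale w c x \<in> ?C" if "x \<in> ?C" "c \<noteq> 0" for c x
    by (rule hypersurface_cone_wscale[OF f(2) that])
  have Zcan: "functional_equation (Zcan w ?C q s) q \<delta>
      (\<Sum>e\<in>?E. jordan_totient (nat (1 - s)) e * euler_char w l (sector_cone w f e))"
    if s: "s \<le> 1" for s
  proof -
    have "functional_equation ((hasse_weil_zeta w (sector_cone w f e) (q ^ ord e q) oo
          fps_X ^ ord e q) ^ nat (jordan_totient (nat (1 - s)) e div int (ord e q))) q \<delta>
        (jordan_totient (nat (1 - s)) e * euler_char w l (sector_cone w f e))"
      (is "functional_equation ((?Z oo _) ^ nat (?J div ?o)) q \<delta> (?J * ?\<chi>)")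
      if e: "e \<in> ?E" for e
    proof (cases "sector_cone w f e = {}")
      case True
      then show ?thesis
        using q1 by (simp add: hasse_weil_zeta_empty euler_char_empty[OF l(1)] functional_equation_one)
    next
      case False
      have e0: "e > 0" using e by (simp add: sector_indices_def)
      have o: "ord e q > 0" using coprime[OF e] ord_eq_0[of e q] by simp
      obtain \<delta>' where "wdim w (sector_cone w f e) = ereal (real \<delta>')"
        "functional_equation ?Z (q ^ ord e q) \<delta>' ?\<chi>"
        using sectors_self_dual[OF e False] by (auto simp: self_dual_def)
      then have "functional_equation ?Z (q ^ ord e q) \<delta> ?\<chi>"
        using sectors_dim[OF e False] by simp
      then have "functional_equation ((?Z oo fps_X ^ ord e q) ^ nat (?J div ?o)) q \<delta>
          (int (nat (?J div ?o)) * (?o * ?\<chi>))"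
        using q1 o by (intro functional_equation_power functional_equation_dilate) auto
      moreover have "int (nat (?J div ?o)) * ?o = ?J"
        by (rule jordan_totient_div_ord[OF e0 coprime[OF e]])
      ultimately show ?thesis by (metis mult.assoc)
    qed
    then have "functional_equation (\<Prod>e\<in>?E. (hasse_weil_zeta w (sector_cone w f e) (q ^ ord e q) oo
          fps_X ^ ord e q) ^ nat (jordan_totient (nat (1 - s)) e div int (ord e q))) q \<delta>
        (\<Sum>e\<in>?E. jordan_totient (nat (1 - s)) e * euler_char w l (sector_cone w f e))"
      using q1 finite_sector_indices[OF w_pos] by (intro functional_equation_prod) auto
    moreover have "Zcan w ?C q s = (\<Prod>e\<in>?E. (hasse_weil_zeta w (sector_cone w f e) (q ^ ord e q) oo
          fps_X ^ ord e q) ^ nat (jordan_totient (nat (1 - s)) e div int (ord e q)))"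
      unfolding sector_cone_def
      using q1 coprime stable nonzero w_pos prime_p w_tame s by (rule Zcan_eq_prod_sectors)
    ultimately show ?thesis by simp
  qed
  moreover have "functional_equation (Ztw w ?C q) q \<delta>
      (\<Sum>e\<in>?E. int (totient e) * euler_char w l (sector_cone w f e))"
  proof -
    have "jordan_totient (nat (1 - 0)) e = int (totient e)" if "e \<in> ?E" for e
      using that jordan_totient_one_eq_totient[of e] by (simp add: sector_indices_def)
    moreover have "Ztw w ?C q = Zcan w ?C q 0"
      using q1 q0 stable nonzero w_nz by (rule Ztw_eq_Zcan)
    ultimately show ?thesis
      using Zcan[of 0] by simp
  qed
  ultimately show ?thesis by blast
qed

end
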